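(* Let $K$ be a field of characteristic zero, $S=K[x_1,\dots,x_n]$, $d\ge2$, $\mathbf t=(t_1,\dots,t_{d-1})\in\mathbb Z_{\ge0}^{d-1}$, and let $I\subset S$ be a $\mathbf t$-spread strongly stable ideal. Then $$I=(\operatorname{Gin}(I))^{\sigma_{\mathbf 0,\mathbf t}}.$$
   Context: A monomial $u=x_{j_1}\cdots x_{j_\ell}$ with $j_1\le\dots\le j_\ell$ and $\ell\le d$ is $\mathbf t$-spread if $j_{r+1}-j_r\ge t_r$ for all $r=1,\dots,\ell-1$ (variables and $1$ are $\mathbf t$-spread). $G(I)$ denotes the minimal monomial generating set of a monomial ideal $I$. $I$ is a $\mathbf t$-spread monomial ideal if all $u\in G(I)$ are $\mathbf t$-spread; it is $\mathbf t$-spread strongly stable if moreover, for every $\mathbf t$-spread monomial $u\in I$ and all $j<i$ with $x_i\mid u$ and $x_j(u/x_i)$ $\mathbf t$-spread, one has $x_j(u/x_i)\in I$. $\operatorname{Gin}(I)$ is the generic initial ideal of $I$ in $S$ with respect to the (graded) reverse lexicographic order with $x_1>x_2>\dots>x_n$. $\sigma_{\mathbf 0,\mathbf t}$ is the map on monomials of degree at most $d$ (in variables $x_1,x_2,\dots$) given by $\sigma_{\mathbf 0,\mathbf t}(1)=1$ and $\sigma_{\mathbf 0,\mathbf t}(x_{j_1}\cdots x_{j_\ell})=\prod_{k=1}^{\ell}x_{j_k+\sum_{s=1}^{k-1}t_s}$ for $j_1\le\dots\le j_\ell$, $1\le \ell\le d$. For a monomial ideal $J$ generated in degrees at most $d$,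 $J^{\sigma_{\mathbf 0,\mathbf t}}$ is the monomial ideal generated by $\{\sigma_{\mathbf 0,\mathbf t}(u):u\in G(J)\}$. (Part of the assertion is that $\operatorname{Gin}(I)$ is generated in degrees at most $d$ and that these generators lie in $S$.) *)

theory Defs
  imports
    "HOL-Library.Poly_Mapping"
    "HOL-Algebra.Ideal"
    "Jordan_Normal_Form.Matrix"
begin

text \<open>
  Variables are indexed from 0: the index \<open>j :: nat\<close> stands for the variable usually written
  \<open>x_(j+1)\<close>, so \<open>S = K[x_1, ..., x_n]\<close> has the variables with index \<open>j < n\<close>, and matrix
  indices agree with variable indices.  The entries of \<open>t = (t_1, ..., t_(d-1))\<close> keep their
  usual numbering from 1; \<open>t\<close> is a function on \<open>nat\<close> of which only these values matter.
\<close>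

type_synonym mon = "nat \<Rightarrow>\<^sub>0 nat"
type_synonym 'a pol = "mon \<Rightarrow>\<^sub>0 'a"


subsection \<open>Monomials\<close>

definition mons :: "nat \<Rightarrow> mon set" where
  "mons n = {u. Poly_Mapping.keys u \<subseteq> {..<n}}"

definition mdeg :: "mon \<Rightarrow> nat" where
  "mdeg u = (\<Sum>i\<in>Poly_Mapping.keys u. Poly_Mapping.lookup u i)"

abbreviation var :: "nat \<Rightarrow> mon" where
  "var i \<equiv> Poly_Mapping.single i 1"

text \<open>The list \<open>[j_1, ..., j_l]\<close> with \<open>j_1 \<le> ... \<le> j_l\<close> and \<open>u = x_(j_1) ... x_(j_l)\<close>.\<close>

definition indices :: "mon \<Rightarrow> nat list" where
  "indices u =
     concat (map (\<lambda>i. replicate (Poly_Mapping.lookup u i) i)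
       (sorted_list_of_set (Poly_Mapping.keys u)))"

text \<open>As lists are indexed from 0, \<open>j_r\<close> is \<open>indices u ! (r - 1)\<close>.\<close>

definition t_spread :: "nat \<Rightarrow> (nat \<Rightarrow> nat) \<Rightarrow> mon \<Rightarrow> bool" where
  "t_spread d t u \<longleftrightarrow> length (indices u) \<le> d \<and>
     (\<forall>r\<in>{1..<length (indices u)}. indices u ! (r - 1) + t r \<le> indices u ! r)"

definition sigma :: "(nat \<Rightarrow> nat) \<Rightarrow> mon \<Rightarrow> mon" where
  "sigma t u = (\<Sum>k\<in>{1..length (indices u)}. var (indices u ! (k - 1) + (\<Sum>s\<in>{1..<k}. t s)))"

text \<open>The graded reverse lexicographic order; a smaller index means a larger variable.\<close>

definition revlex_less :: "mon \<Rightarrow> mon \<Rightarrow> bool" where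
  "revlex_less u v \<longleftrightarrow> mdeg u < mdeg v \<or>
     (mdeg u = mdeg v \<and> (\<exists>k. Poly_Mapping.lookup v k < Poly_Mapping.lookup u k \<and>
        (\<forall>i>k. Poly_Mapping.lookup u i = Poly_Mapping.lookup v i)))"


subsection \<open>The polynomial ring and its monomial ideals\<close>

definition S :: "nat \<Rightarrow> 'a::field pol ring" where
  "S n = \<lparr>carrier = {p. Poly_Mapping.keys p \<subseteq> mons n}, monoid.mult = (*), one = 1, zero = 0, add = (+)\<rparr>"

abbreviation mon_pol :: "mon \<Rightarrow> 'a::field pol" where
  "mon_pol u \<equiv> Poly_Mapping.single u 1"

definition mon_ideal :: "nat \<Rightarrow> mon set \<Rightarrow> 'a::field pol set" where
  "mon_ideal n M = genideal (S n) (mon_pol ` M)"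

definition monomial_ideal :: "nat \<Rightarrow> 'a::field pol set \<Rightarrow> bool" where
  "monomial_ideal n I \<longleftrightarrow> (\<exists>M\<subseteq>mons n. I = mon_ideal n M)"

text \<open>The minimal monomial generating set; it exists and is unique for every monomial ideal.\<close>

definition G :: "nat \<Rightarrow> 'a::field pol set \<Rightarrow> mon set" where
  "G n I = (THE M. M \<subseteq> mons n \<and> mon_ideal n M = I \<and> (\<forall>N. N \<subset> M \<longrightarrow> mon_ideal n N \<noteq> I))"

definition t_spread_ideal :: "nat \<Rightarrow> nat \<Rightarrow> (nat \<Rightarrow> nat) \<Rightarrow> 'a::field pol set \<Rightarrow> bool" where
  "t_spread_ideal n d t I \<longleftrightarrow> monomial_ideal n I \<and> (\<forall>u\<in>G n I. t_spread d t u)"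

definition t_spread_strongly_stable ::
    "nat \<Rightarrow> nat \<Rightarrow> (nat \<Rightarrow> nat) \<Rightarrow> 'a::field pol set \<Rightarrow> bool" where
  "t_spread_strongly_stable n d t I \<longleftrightarrow> t_spread_ideal n d t I \<and>
     (\<forall>u i j. t_spread d t u \<and> mon_pol u \<in> I \<and> j < i \<and> i \<in> Poly_Mapping.keys u \<and>
        t_spread d t (var j + (u - var i)) \<longrightarrow> mon_pol (var j + (u - var i)) \<in> I)"

definition sigma_ideal :: "nat \<Rightarrow> (nat \<Rightarrow> nat) \<Rightarrow> 'a::field pol set \<Rightarrow> 'a pol set" where
  "sigma_ideal n t J = mon_ideal n (sigma t ` G n J)"


subsection \<open>Initial ideals\<close>

definition lead_mon :: "'a::field pol \<Rightarrow> mon" where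
  "lead_mon f = (THE u. u \<in> Poly_Mapping.keys f \<and> (\<forall>v\<in>Poly_Mapping.keys f. v \<noteq> u \<longrightarrow> revlex_less v u))"

definition initial_ideal :: "nat \<Rightarrow> 'a::field pol set \<Rightarrow> 'a pol set" where
  "initial_ideal n J = mon_ideal n (lead_mon ` (J - {0}))"


subsection \<open>Generic initial ideals\<close>

text \<open>Substitution of \<open>x v\<close> for each variable \<open>v\<close>, with coefficients mapped by \<open>c\<close>.\<close>

definition subst_pol ::
    "('a::zero \<Rightarrow> 'b::comm_semiring_1) \<Rightarrow> ('v \<Rightarrow> 'b) \<Rightarrow> (('v \<Rightarrow>\<^sub>0 nat) \<Rightarrow>\<^sub>0 'a) \<Rightarrow> 'b" where
  "subst_pol c x p = (\<Sum>m\<in>Poly_Mapping.keys p.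
     c (Poly_Mapping.lookup p m) *
     (\<Prod>v\<in>Poly_Mapping.keys m. x v ^ Poly_Mapping.lookup m v))"

definition GL :: "nat \<Rightarrow> 'a::field mat set" where
  "GL n = {g \<in> carrier_mat n n. invertible_mat g}"

text \<open>The linear change of coordinates sending \<open>x_j\<close> to the sum of all \<open>g_(i,j) x_i\<close>.\<close>

definition gl_act :: "nat \<Rightarrow> 'a::field mat \<Rightarrow> 'a pol \<Rightarrow> 'a pol" where
  "gl_act n g = subst_pol (Poly_Mapping.single 0)
     (\<lambda>j. \<Sum>i<n. Poly_Mapping.single (var i) (g $$ (i, j)))"

text \<open>
  Zariski-open subsets of \<open>GL_n(K)\<close>: the complements of the common zero loci of sets \<open>F\<close> of
  polynomials in the matrix entries.
\<close>

definition zariski_open_GL :: "nat \<Rightarrow> 'a::field mat set \<Rightarrow> bool" where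
  "zariski_open_GL n U \<longleftrightarrow>
     (\<exists>F :: ((nat \<times> nat \<Rightarrow>\<^sub>0 nat) \<Rightarrow>\<^sub>0 'a) set.
        (\<forall>f\<in>F. \<forall>m\<in>Poly_Mapping.keys f. Poly_Mapping.keys m \<subseteq> {..<n} \<times> {..<n}) \<and>
        U = {g \<in> GL n. \<exists>f\<in>F. subst_pol id (\<lambda>e. g $$ e) f \<noteq> 0})"

text \<open>
  Over an infinite field two nonempty Zariski-open subsets of \<open>GL_n(K)\<close> meet, so the
  description below determines at most one ideal; one exists if \<open>I\<close> is homogeneous.
\<close>

definition Gin :: "nat \<Rightarrow> 'a::field pol set \<Rightarrow> 'a pol set" where
  "Gin n I = (THE J. \<exists>U. zariski_open_GL n U \<and> U \<noteq> {} \<and>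
     (\<forall>g\<in>U. initial_ideal n (gl_act n g ` I) = J))"

end

theory Submission
  imports Defs "HOL-Library.Multiset" "Jordan_Normal_Form.Determinant"
begin

text \<open>
  Let \<open>T\<close> be the set of (index lists of) \<open>t\<close>-spread monomials of \<open>I\<close>, let \<open>\<tau>\<close> be the inverse of
  \<open>\<sigma>\<close> on spread lists, let \<open>J\<close> be the ideal generated by \<open>\<tau>(T)\<close>, and let \<open>L_j = g x_j\<close> for a
  matrix \<open>g\<close> in general position. The claim is \<open>in(gI) = J\<close>.

  Every monomial of \<open>I\<close> is \<open>u y\<close> with \<open>u\<close> its greedy spread divisor in \<open>T\<close>, where \<open>y\<close> only involves
  as many variables as there are from the last variable of \<open>\<tau>(u)\<close> on. Hence \<open>I\<close> has at most as many
  monomials of degree at most \<open>D\<close> as \<open>J\<close>, and it suffices to show that \<open>in(gI)\<close> contains \<open>\<tau>(T)\<close>.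

  First let \<open>T\<close> consist of all spread lists of length \<open>k\<close> below \<open>a + t_1 + ... + t_(k-1)\<close>. By
  induction the corresponding products of the \<open>L_j\<close> span the forms of degree \<open>k\<close> modulo the variables
  with index at least \<open>a\<close>, so \<open>in(gI)\<close> contains, hence is generated by, the monomials of degree \<open>k\<close>
  in the first \<open>a\<close> variables. In general, for \<open>u\<close> in \<open>T\<close> of degree \<open>l\<close>, let \<open>V\<close> be spanned by the
  spread monomials of degree \<open>l\<close> that are componentwise at most \<open>u\<close>. Applying the first case to all
  prefixes of \<open>u\<close> shows that the monomials of \<open>in(gV)\<close> are componentwise at most \<open>\<tau>(u)\<close>. There are
  only \<open>dim V\<close> such monomials, so all of them, in particular \<open>\<tau>(u)\<close>, occur.
\<close>

subsection \<open>Monomials as index lists\<close>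

abbreviation keys :: "('b \<Rightarrow>\<^sub>0 'c::zero) \<Rightarrow> 'b set" where "keys \<equiv> Poly_Mapping.keys"
abbreviation lookup :: "('b \<Rightarrow>\<^sub>0 'c::zero) \<Rightarrow> 'b \<Rightarrow> 'c" where "lookup \<equiv> Poly_Mapping.lookup"

definition mon_of :: "nat list \<Rightarrow> mon" where
  "mon_of xs = sum_list (map var xs)"

lemma mon_of_Nil [simp]: "mon_of [] = 0"
  and mon_of_Cons [simp]: "mon_of (x # xs) = var x + mon_of xs"
  and mon_of_append [simp]: "mon_of (xs @ ys) = mon_of xs + mon_of ys"
  by (simp_all add: mon_of_def)

lemma lookup_mon_of: "lookup (mon_of xs) i = count_list xs i"
  by (induction xs) (auto simp: lookup_add lookup_single when_def)

lemma keys_mon_of [simp]: "keys (mon_of xs) = set xs"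
  by (auto simp: in_keys_iff lookup_mon_of count_list_0_iff)

lemma keys_add_mon: "keys (u + v) = keys u \<union> keys (v :: mon)"
  by (auto simp: in_keys_iff lookup_add)

lemma mons_add_iff [simp]: "u + v \<in> mons n \<longleftrightarrow> u \<in> mons n \<and> v \<in> mons n"
  by (auto simp: mons_def keys_add_mon)

lemma mons_0 [simp]: "0 \<in> mons n"
  by (simp add: mons_def)

lemma var_in_mons [simp]: "var i \<in> mons n \<longleftrightarrow> i < n"
  by (simp add: mons_def)

lemma mon_of_in_mons: "mon_of xs \<in> mons n \<longleftrightarrow> set xs \<subseteq> {..<n}"
  by (simp add: mons_def)

lemma mdeg_superset: "finite A \<Longrightarrow> keys u \<subseteq> A \<Longrightarrow> mdeg u = (\<Sum>i\<in>A. lookup u i)"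
  unfolding mdeg_def by (rule sum.mono_neutral_left) (auto simp: in_keys_iff)

lemma mdeg_add [simp]: "mdeg (u + v) = mdeg u + mdeg v"
proof -
  have "mdeg w = (\<Sum>i\<in>keys u \<union> keys v. lookup w i)" if "w \<in> {u, v, u + v}" for w
    using that by (intro mdeg_superset) (auto simp: keys_add_mon)
  then show ?thesis
    by (simp add: lookup_add sum.distrib)
qed

lemma mdeg_0 [simp]: "mdeg 0 = 0"
  by (simp add: mdeg_def)

lemma mdeg_single [simp]: "mdeg (Poly_Mapping.single i k) = k"
  by (simp add: mdeg_def)

lemma mdeg_eq_0_iff: "mdeg u = 0 \<longleftrightarrow> u = 0"
  by (simp add: mdeg_def in_keys_iff poly_mapping_eq_iff fun_eq_iff)

lemma mdeg_mon_of [simp]: "mdeg (mon_of xs) = length xs"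
  by (induction xs) simp_all

lemma sorted_concat_replicate:
  "sorted xs \<Longrightarrow> sorted (concat (map (\<lambda>i. replicate (f i) i) xs))"
  by (induction xs) (auto simp: sorted_append)

lemma sorted_indices: "sorted (indices u)"
  by (simp add: indices_def sorted_concat_replicate)

lemma mon_of_replicate: "mon_of (replicate k i) = Poly_Mapping.single i k"
  by (induction k) (simp_all flip: single_add)

lemma mon_of_concat_replicate:
  "distinct xs \<Longrightarrow> mon_of (concat (map (\<lambda>i. replicate (f i) i) xs))
     = (\<Sum>i\<in>set xs. Poly_Mapping.single i (f i))"
  by (induction xs) (simp_all add: mon_of_replicate)

lemma sum_single_lookup: "(\<Sum>i\<in>keys p. Poly_Mapping.single i (lookup p i)) = p"
  by (rule poly_mapping_eqI) (auto simp: lookup_sum lookup_single when_def in_keys_iff)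

lemma mon_of_indices [simp]: "mon_of (indices u) = u"
  by (simp add: indices_def mon_of_concat_replicate sum_single_lookup)

lemma mset_eq_iff_mon_of: "mset xs = mset ys \<longleftrightarrow> mon_of xs = mon_of ys"
  by (auto simp: multiset_eq_iff poly_mapping_eq_iff lookup_mon_of count_mset fun_eq_iff)

lemma indices_mon_of: "sorted xs \<Longrightarrow> indices (mon_of xs) = xs"
  by (metis mon_of_indices mset_eq_iff_mon_of properties_for_sort sorted_indices sorted_sort_id)

lemma set_indices [simp]: "set (indices u) = keys u"
  by (metis keys_mon_of mon_of_indices)

lemma length_indices [simp]: "length (indices u) = mdeg u"
  by (metis mdeg_mon_of mon_of_indices)

lemma var_add_minus: "i \<in> keys u \<Longrightarrow> var i + (u - var i) = u"
  by (auto intro!: poly_mapping_eqI simp: lookup_add lookup_minus lookup_single when_def in_keys_iff)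

lemma mon_of_list_update_add:
  assumes "p < length xs"
  shows "mon_of xs + var q = mon_of (xs[p := q]) + var (xs ! p)"
  using assms arg_cong[OF id_take_nth_drop[OF assms], of mon_of]
  by (simp add: upd_conv_take_nth_drop ac_simps)

text \<open>At least p + 1 entries of \<open>xs\<close>, and hence of \<open>ys\<close>, are at most
  \<open>xs ! p\<close>. If \<open>ys ! p\<close> were larger, sortedness of \<open>ys\<close> would
  leave at most p such entries.\<close>

lemma sorted_mset_subset_nth_le:
  fixes xs ys :: "nat list"
  assumes "sorted xs" "sorted ys" "mset xs \<subseteq># mset ys" "p < length xs"
  shows "ys ! p \<le> xs ! p"
proof (rule ccontr)
  assume "\<not> ys ! p \<le> xs ! p"
  then have less: "xs ! p < ys ! p" by simp
  have ys: "length (filter (\<lambda>z. z \<le> xs ! p) ys) \<le> p"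
  proof -
    have "filter (\<lambda>z. z \<le> xs ! p) (drop p ys) = []"
    proof (clarsimp simp: filter_empty_conv in_set_conv_nth)
      fix i assume "i < length ys - p" "ys ! (p + i) \<le> xs ! p"
      moreover have "ys ! p \<le> ys ! (p + i)"
        using \<open>i < length ys - p\<close> by (intro sorted_nth_mono[OF assms(2)]) auto
      ultimately show False
        using less by simp
    qed
    then have "filter (\<lambda>z. z \<le> xs ! p) ys = filter (\<lambda>z. z \<le> xs ! p) (take p ys)"
      by (metis append.right_neutral append_take_drop_id filter_append)
    then show ?thesis
      by (metis length_filter_le length_take min.bounded_iff)
  qed
  have "Suc p = length (filter (\<lambda>z. z \<le> xs ! p) (take (Suc p) xs))"
    using assms(4) sorted_nth_mono[OF assms(1)]
    by (subst filter_True) (auto simp: in_set_conv_nth less_Suc_eq_le)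
  also have "\<dots> \<le> length (filter (\<lambda>z. z \<le> xs ! p) xs)"
    by (metis append_take_drop_id filter_append le_add1 length_append)
  also have "\<dots> \<le> length (filter (\<lambda>z. z \<le> xs ! p) ys)"
    using size_mset_mono[OF multiset_filter_mono[OF assms(3), of "\<lambda>z. z \<le> xs ! p"]]
    by (simp flip: size_mset mset_filter)
  finally show False using ys by simp
qed

text \<open>Divisibility read off from sorted index lists: a multiple has more entries, and
  inserting entries can only lower the one at a given position.\<close>

lemma mon_of_dvd_nth_le:
  assumes "mon_of xs + y = mon_of ys" "sorted xs" "sorted ys"
  shows "length xs \<le> length ys" "p < length xs \<Longrightarrow> ys ! p \<le> xs ! p"
proof -
  have "mset ys = mset xs + mset (indices y)"
    using assms(1) mset_eq_iff_mon_of[of ys "xs @ indices y"] by simp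
  then have *: "mset xs \<subseteq># mset ys" by simp
  then show "length xs \<le> length ys" by (metis size_mset size_mset_mono)
  show "ys ! p \<le> xs ! p" if "p < length xs"
    using sorted_mset_subset_nth_le[OF assms(2,3) * that] .
qed

section \<open>Counting monomials of bounded degree\<close>

definition mons_le :: "nat set \<Rightarrow> nat \<Rightarrow> mon set" where
  "mons_le X m = {y. keys y \<subseteq> X \<and> mdeg y \<le> m}"

lemma finite_mons_le: "finite X \<Longrightarrow> finite (mons_le X m)"
proof -
  assume "finite X"
  have "mons_le X m \<subseteq> mon_of ` {xs. set xs \<subseteq> X \<and> length xs \<le> m}"
  proof
    fix y assume "y \<in> mons_le X m"
    then show "y \<in> mon_of ` {xs. set xs \<subseteq> X \<and> length xs \<le> m}"
      by (intro image_eqI[of _ _ "indices y"]) (auto simp: mons_le_def)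
  qed
  then show ?thesis
    using finite_lists_length_le[OF \<open>finite X\<close>] by (rule finite_surj[rotated])
qed

text \<open>An injection of the variables in \<open>X\<close> into \<open>Y\<close> renames
  monomials injectively and preserves degrees.\<close>

lemma card_mons_le_mono:
  assumes "finite X" "finite Y" "card X \<le> card Y"
  shows "card (mons_le X m) \<le> card (mons_le Y m)"
proof -
  obtain f where f: "inj_on f X" "f ` X \<subseteq> Y"
    using card_le_inj[OF assms] by blast
  let ?F = "\<lambda>y. mon_of (map f (indices y))"
  have eq: "lookup (?F y) (f i) = lookup y i" if "keys y \<subseteq> X" "i \<in> X" for y i
  proof -
    have "count_list (map f xs) (f i) = count_list xs i" if "set xs \<subseteq> X" for xs
      using that \<open>i \<in> X\<close> f(1) by (induction xs) (auto dest: inj_onD)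
    then show ?thesis
      using that(1) by (metis lookup_mon_of mon_of_indices set_indices)
  qed
  then have "inj_on ?F (mons_le X m)"
  proof (intro inj_onI poly_mapping_eqI)
    fix y z i
    assume *: "y \<in> mons_le X m" "z \<in> mons_le X m" "?F y = ?F z"
    show "lookup y i = lookup z i"
    proof (cases "i \<in> X")
      case True
      then show ?thesis
        using *(1,2) eq[of y i] eq[of z i] *(3) by (simp add: mons_le_def)
    next
      case False
      then have "i \<notin> keys y" "i \<notin> keys z"
        using *(1,2) by (auto simp: mons_le_def)
      then show ?thesis
        by (simp add: in_keys_iff)
    qed
  qed
  moreover have "?F ` mons_le X m \<subseteq> mons_le Y m"
    using f(2) by (force simp: mons_le_def)
  ultimately show ?thesis
    by (metis card_inj_on_le finite_mons_le assms(2))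
qed

subsection \<open>Spread lists\<close>

text \<open>The gap condition of \<open>t_spread\<close> without the degree bound, for index lists.
  Positions count from 0, so the gap after position r is \<open>t (Suc r)\<close>.\<close>

definition spread :: "(nat \<Rightarrow> nat) \<Rightarrow> nat list \<Rightarrow> bool" where
  "spread t xs \<longleftrightarrow> (\<forall>r. Suc r < length xs \<longrightarrow> xs ! r + t (Suc r) \<le> xs ! Suc r)"

definition offset :: "(nat \<Rightarrow> nat) \<Rightarrow> nat \<Rightarrow> nat" where
  "offset t p = (\<Sum>s\<in>{1..p}. t s)"

lemma offset_0 [simp]: "offset t 0 = 0"
  and offset_Suc [simp]: "offset t (Suc p) = offset t p + t (Suc p)"
  by (simp_all add: offset_def)

definition shift_up :: "(nat \<Rightarrow> nat) \<Rightarrow> nat list \<Rightarrow> nat list" where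
  "shift_up t xs = map (\<lambda>p. xs ! p + offset t p) [0..<length xs]"

text \<open>The inverse of \<open>shift_up\<close> on spread lists. The truncated subtraction is
  exact there, because entry p of a spread list is at least \<open>offset t p\<close>.\<close>

definition shift_down :: "(nat \<Rightarrow> nat) \<Rightarrow> nat list \<Rightarrow> nat list" where
  "shift_down t xs = map (\<lambda>p. xs ! p - offset t p) [0..<length xs]"

lemma length_shift_up [simp]: "length (shift_up t xs) = length xs"
  and length_shift_down [simp]: "length (shift_down t xs) = length xs"
  and nth_shift_up [simp]: "p < length xs \<Longrightarrow> shift_up t xs ! p = xs ! p + offset t p"
  and nth_shift_down [simp]: "p < length xs \<Longrightarrow> shift_down t xs ! p = xs ! p - offset t p"
  by (simp_all add: shift_up_def shift_down_def)

lemma t_spread_iff: "t_spread d t u \<longleftrightarrow> mdeg u \<le> d \<and> spread t (indices u)"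
proof -
  have "(\<forall>r\<in>{1..<m}. P r) \<longleftrightarrow> (\<forall>r. Suc r < m \<longrightarrow> P (Suc r))" for P m
  proof
    assume *: "\<forall>r. Suc r < m \<longrightarrow> P (Suc r)"
    show "\<forall>r\<in>{1..<m}. P r"
    proof
      fix r assume "r \<in> {1..<m}"
      then show "P r"
        using * by (cases r) auto
    qed
  qed auto
  then show ?thesis
    by (simp add: t_spread_def spread_def)
qed

lemma sigma_eq: "sigma t u = mon_of (shift_up t (indices u))"
proof -
  have "sigma t u = (\<Sum>p<length (indices u). var (indices u ! p + offset t p))"
    unfolding sigma_def
    by (rule sum.reindex_bij_witness[of _ Suc "\<lambda>k. k - 1"])
       (auto simp: offset_def atLeastLessThanSuc_atLeastAtMost Suc_diff_le
         simp flip: atLeastLessThanSuc_atLeastAtMost)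
  also have "\<dots> = mon_of (shift_up t (indices u))"
    by (simp add: mon_of_def shift_up_def interv_sum_list_conv_sum_set_nat o_def atLeast0LessThan
        del: length_indices)
  finally show ?thesis .
qed

lemma spread_take: "spread t xs \<Longrightarrow> spread t (take k xs)"
  by (simp add: spread_def)

lemma spread_sorted: "spread t xs \<Longrightarrow> sorted xs"
  unfolding spread_def sorted_iff_nth_Suc by (meson add_leD1)

text \<open>The gaps between p and q add up. Written without subtraction, this is the monotonicity
  of \<open>shift_down t xs\<close>.\<close>

lemma spread_offset_mono:
  assumes "spread t xs" "p \<le> q" "q < length xs"
  shows "xs ! p + offset t q \<le> xs ! q + offset t p"
  using assms(2,3)
proof (induction q rule: dec_induct)
  case (step q)
  then show ?case
    using assms(1)[unfolded spread_def, rule_format, of q] by simp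
qed simp

lemma spread_offset_le:
  assumes "spread t xs" "q < length xs"
  shows "offset t q \<le> xs ! q"
  using spread_offset_mono[OF assms(1), of 0 q] assms(2) by simp

lemma sorted_shift_down: "spread t xs \<Longrightarrow> sorted (shift_down t xs)"
proof (clarsimp simp: sorted_iff_nth_mono)
  fix p q assume "spread t xs" "p \<le> q" "q < length xs"
  from spread_offset_mono[OF this] show "xs ! p - offset t p \<le> xs ! q - offset t q"
    by simp
qed

lemma spread_shift_up: "sorted xs \<Longrightarrow> spread t (shift_up t xs)"
  by (auto simp: spread_def sorted_iff_nth_Suc)

lemma shift_up_down: "spread t xs \<Longrightarrow> shift_up t (shift_down t xs) = xs"
  by (rule nth_equalityI) (simp_all add: spread_offset_le)

lemma shift_down_up [simp]: "shift_down t (shift_up t xs) = xs"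
  by (rule nth_equalityI) simp_all

lemma shift_up_take: "shift_up t (take k xs) = take k (shift_up t xs)"
  by (rule nth_equalityI) simp_all

lemma shift_up_mono: "list_all2 (\<le>) xs ys \<Longrightarrow> list_all2 (\<le>) (shift_up t xs) (shift_up t ys)"
  by (auto simp: list_all2_conv_all_nth)

lemma shift_down_set_less: "set xs \<subseteq> {..<n} \<Longrightarrow> set (shift_down t xs) \<subseteq> {..<n}"
  by (force simp: shift_down_def subset_iff less_imp_diff_less)


section \<open>Multiples of a set of monomials: the monomials of the ideal it generates\<close>

definition up :: "nat \<Rightarrow> mon set \<Rightarrow> mon set" where
  "up n M = {m + v |m v. m \<in> M \<and> v \<in> mons n}"

lemma up_mono: "M \<subseteq> N \<Longrightarrow> up n M \<subseteq> up n N"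
  by (auto simp: up_def)

lemma subset_up: "M \<subseteq> up n M"
proof
  fix m assume "m \<in> M"
  then have "m + 0 \<in> up n M"
    unfolding up_def using mons_0 by blast
  then show "m \<in> up n M" by simp
qed

lemma up_subset_mons: "M \<subseteq> mons n \<Longrightarrow> up n M \<subseteq> mons n"
  by (auto simp: up_def)

lemma up_add: "u \<in> up n M \<Longrightarrow> v \<in> mons n \<Longrightarrow> u + v \<in> up n M"
proof -
  assume "u \<in> up n M" "v \<in> mons n"
  then obtain m w where "m \<in> M" "w \<in> mons n" "u = m + w"
    by (auto simp: up_def)
  then have "u + v = m + (w + v)" "w + v \<in> mons n"
    using \<open>v \<in> mons n\<close> by (simp_all add: add.assoc)
  then show ?thesis
    using \<open>m \<in> M\<close> unfolding up_def by blast
qed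

lemma up_up [simp]: "up n (up n M) = up n M"
proof
  show "up n (up n M) \<subseteq> up n M"
    unfolding up_def[of n "up n M"] using up_add by blast
qed (rule subset_up)

text \<open>The variables by which the greedy spread divisor \<open>xs\<close> of a monomial may be multiplied
  without changing that divisor.\<close>

definition allowed :: "(nat \<Rightarrow> nat) \<Rightarrow> nat \<Rightarrow> nat list \<Rightarrow> nat set" where
  "allowed t n xs =
     {q\<in>{..<n}. \<forall>p<length xs. q < xs ! p \<longrightarrow> 0 < p \<and> q < xs ! (p - 1) + t p}"

text \<open>The counterpart of \<open>allowed\<close> for sorted lists: multiplying by these
  variables keeps \<open>xs\<close> as a prefix of the index list.\<close>

definition above :: "nat \<Rightarrow> nat list \<Rightarrow> nat set" where
  "above n xs = {q\<in>{..<n}. \<forall>x\<in>set xs. x \<le> q}"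

lemma finite_allowed [simp]: "finite (allowed t n xs)"
  and finite_above [simp]: "finite (above n xs)"
  by (simp_all add: allowed_def above_def)

lemma offset_mono: "p \<le> q \<Longrightarrow> offset t p \<le> offset t q"
  by (simp add: offset_def sum_mono2)

text \<open>Let m be the last entry of \<open>shift_down t xs\<close>. The right side is at least n
  - m, so it suffices to exhibit m forbidden variables among the n.\<close>

lemma card_allowed_le:
  assumes "spread t xs" "set xs \<subseteq> {..<n}"
  shows "card (allowed t n xs) \<le> card (above n (shift_down t xs))"
proof (cases "xs = []")
  case True
  then show ?thesis by (simp add: allowed_def above_def shift_down_def)
next
  case False
  define l where "l = length xs - 1"
  define m where "m = xs ! l - offset t l"
  have l: "l < length xs" and lt: "p < length xs \<longleftrightarrow> p \<le> l" for p
    using False unfolding l_def by (cases xs; auto)+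
  have xsn: "xs ! p < n" if "p < length xs" for p
    using assms(2) nth_mem[OF that] by auto
  have "{m..<n} \<subseteq> above n (shift_down t xs)"
  proof
    fix q assume q: "q \<in> {m..<n}"
    have "x \<le> m" if x: "x \<in> set (shift_down t xs)" for x
    proof -
      obtain p where p: "p < length xs" "x = shift_down t xs ! p"
        using x unfolding in_set_conv_nth by auto
      moreover have "shift_down t xs ! p \<le> shift_down t xs ! l"
        using p(1) l lt[of p] by (intro sorted_nth_mono[OF sorted_shift_down[OF assms(1)]]) simp_all
      ultimately show ?thesis
        using l by (simp add: m_def)
    qed
    then show "q \<in> above n (shift_down t xs)"
      using q by (fastforce simp: above_def)
  qed
  then have B: "n - m \<le> card (above n (shift_down t xs))"
    using card_mono[OF finite_above] by (metis card_atLeastLessThan)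
  \<comment> \<open>For c < m let p be the first position at which \<open>shift_down t xs\<close>
    exceeds c. Then \<open>h c\<close>, which is c raised by the offset of p, lies below
    \<open>xs ! p\<close> but not below \<open>xs ! (p - 1) + t p\<close>, so it is
    forbidden.\<close>
  define P where "P c p \<longleftrightarrow> p < length xs \<and> c + offset t p < xs ! p" for c p
  define h where "h c = c + offset t (LEAST p. P c p)" for c
  have least: "P c (LEAST p. P c p)" if "c < m" for c
    by (rule LeastI[of _ l]) (use that l in \<open>simp add: P_def m_def\<close>)
  have h: "h c \<in> {..<n} - allowed t n xs" if "c < m" for c
  proof -
    define p where "p = (LEAST p. P c p)"
    have p: "p < length xs" "h c < xs ! p"
      using least[OF that] by (auto simp: p_def P_def h_def)
    have "xs ! (p - 1) + t p \<le> h c" if "0 < p"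
    proof -
      have "\<not> P c (p - 1)"
        using not_less_Least[of "p - 1" "P c"] that by (simp add: p_def)
      then have "xs ! (p - 1) \<le> c + offset t (p - 1)"
        using p(1) by (auto simp: P_def)
      moreover have "offset t p = offset t (p - 1) + t p"
        using that by (cases p) auto
      ultimately show ?thesis
        by (simp add: h_def p_def)
    qed
    then show ?thesis
      using p xsn[OF p(1)] by (fastforce simp: allowed_def)
  qed
  \<comment> \<open>A larger c is exceeded no earlier, so its offset is at least as large.\<close>
  have "strict_mono_on {..<m} h"
  proof (rule strict_mono_onI)
    fix c c' assume *: "c \<in> {..<m}" "c' \<in> {..<m}" "c < c'"
    then have "P c (LEAST p. P c' p)"
      using least[of c'] by (auto simp: P_def)
    then have "offset t (LEAST p. P c p) \<le> offset t (LEAST p. P c' p)"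
      by (intro offset_mono Least_le)
    then show "h c < h c'"
      using * by (simp add: h_def)
  qed
  then have "inj_on h {..<m}"
    by (rule strict_mono_on_imp_inj_on)
  then have "m \<le> card ({..<n} - allowed t n xs)"
    using card_inj_on_le[of h "{..<m}"] h by (auto simp: image_subset_iff)
  also have "\<dots> = n - card (allowed t n xs)"
    by (subst card_Diff_subset) (auto simp: allowed_def)
  finally have "m \<le> n - card (allowed t n xs)" .
  moreover have "card (allowed t n xs) \<le> n"
    using card_mono[of "{..<n}" "allowed t n xs"] by (auto simp: allowed_def)
  ultimately show ?thesis
    using B by linarith
qed

text \<open>The exchange property of the ideal in terms of index lists: entries may be lowered as
  long as the list stays spread. It is instantiated with the spread monomials of the ideal and with
  the sets \<open>spread_below\<close>.\<close>

locale spread_stable =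
  fixes t :: "nat \<Rightarrow> nat" and n :: nat and T :: "nat list set"
  assumes finite_T: "finite T"
    and spread_T: "xs \<in> T \<Longrightarrow> spread t xs"
    and bound_T: "xs \<in> T \<Longrightarrow> set xs \<subseteq> {..<n}"
    and down_T: "xs \<in> T \<Longrightarrow> spread t ys \<Longrightarrow> list_all2 (\<le>) ys xs \<Longrightarrow> ys \<in> T"
begin

text \<open>Every list of \<open>T\<close> has exactly one prefix of this kind. These lists index
  the pieces into which the monomials of both ideals are sorted.\<close>

definition prefix_min :: "nat list set" where
  "prefix_min = {xs\<in>T. \<forall>k<length xs. take k xs \<notin> T}"

text \<open>The divisor is chosen in \<open>T\<close> of minimal length and then with minimal sum of indices; this is
  the greedy one.\<close>

lemma up_cover:
  assumes "w \<in> up n (mon_of ` T)"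
  shows "\<exists>xs\<in>prefix_min. \<exists>y. keys y \<subseteq> allowed t n xs \<and> w = mon_of xs + y"
proof -
  define C where "C = {xs\<in>T. \<exists>y\<in>mons n. w = mon_of xs + y}"
  have "\<exists>xs. xs \<in> C"
    using assms by (auto simp: C_def up_def)
  then obtain xs where xs: "xs \<in> C"
      and min: "\<And>ys. (ys, xs) \<in> measures [length, sum_list] \<Longrightarrow> ys \<notin> C"
    using wfE_min[OF wf_measures] by metis
  obtain y where y: "xs \<in> T" "y \<in> mons n" "w = mon_of xs + y"
    using xs by (auto simp: C_def)
  have "xs \<in> prefix_min"
    unfolding prefix_min_def
  proof (intro CollectI conjI allI impI y(1) notI)
    fix k assume k: "k < length xs" "take k xs \<in> T"
    have "mon_of xs = mon_of (take k xs) + mon_of (drop k xs)"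
      by (metis append_take_drop_id mon_of_append)
    moreover have "mon_of (drop k xs) \<in> mons n"
      using bound_T[OF y(1)] set_drop_subset[of k xs] by (auto simp: mons_def)
    ultimately have "take k xs \<in> C"
      using k y by (auto simp: C_def add.assoc)
    then show False
      using min[of "take k xs"] k by simp
  qed
  moreover have "keys y \<subseteq> allowed t n xs"
  proof
    fix q assume q: "q \<in> keys y"
    have "0 < p \<and> q < xs ! (p - 1) + t p" if p: "p < length xs" "q < xs ! p" for p
    proof (rule ccontr)
      assume neg: "\<not> (0 < p \<and> q < xs ! (p - 1) + t p)"
      \<comment> \<open>By \<open>neg\<close>, entry p may be lowered to q without violating the gap
        before it, and \<open>xs ! p\<close> moves into the cofactor. The new list has the same
        length and a smaller sum, against the choice of \<open>xs\<close>.\<close>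
      let ?ys = "xs[p := q]"
      have sp: "xs ! r + t (Suc r) \<le> xs ! Suc r" if "Suc r < length xs" for r
        using spread_T[OF y(1)] that by (simp add: spread_def)
      have "spread t ?ys"
        unfolding spread_def
      proof (intro allI impI)
        fix r assume r: "Suc r < length ?ys"
        show "?ys ! r + t (Suc r) \<le> ?ys ! Suc r"
          using sp[of r] r p neg by (auto simp: nth_list_update)
      qed
      moreover have "list_all2 (\<le>) ?ys xs"
        using p by (auto simp: list_all2_conv_all_nth nth_list_update)
      ultimately have "?ys \<in> T"
        using down_T[OF y(1)] by blast
      moreover have "w = mon_of ?ys + (var (xs ! p) + (y - var q))"
      proof -
        have "mon_of xs + (var q + (y - var q)) = mon_of ?ys + (var (xs ! p) + (y - var q))"
          using mon_of_list_update_add[OF p(1), of q] by (simp only: flip: add.assoc)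
        then show ?thesis
          using y(3) unfolding var_add_minus[OF q] by simp
      qed
      moreover have "var (xs ! p) + (y - var q) \<in> mons n"
        using bound_T[OF \<open>?ys \<in> T\<close>] bound_T[OF y(1)] p(1) y(2)
        by (auto simp: mons_def in_keys_iff lookup_minus lookup_add lookup_single when_def subset_iff
            split: if_splits)
      ultimately have "?ys \<in> C"
        by (auto simp: C_def)
      moreover have "sum_list ?ys < sum_list xs"
        using p elem_le_sum_list[OF p(1)] by (simp add: sum_list_update)
      ultimately show False
        using min[of ?ys] by simp
    qed
    moreover have "q < n"
      using q y(2) by (auto simp: mons_def)
    ultimately show "q \<in> allowed t n xs"
      by (auto simp: allowed_def)
  qed
  ultimately show ?thesis
    using y by blast
qed

text \<open>Since the cofactors only involve variables in \<open>above\<close>, the index lists of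
  the two products start with the shifted lists. Hence one shifted list is a prefix of the other;
  shifting back up, \<open>xs\<close> is a prefix of \<open>ys\<close>, and minimality leaves only
  equality.\<close>

lemma prefix_min_shift_down_disjoint:
  assumes "xs \<in> prefix_min" "ys \<in> prefix_min" "length xs \<le> length ys"
    and "keys v \<subseteq> above n (shift_down t xs)" "keys w \<subseteq> above n (shift_down t ys)"
    and "mon_of (shift_down t xs) + v = mon_of (shift_down t ys) + w"
  shows "xs = ys"
proof -
  have ind: "indices (mon_of (shift_down t zs) + u) = shift_down t zs @ indices u"
    if "zs \<in> prefix_min" "keys u \<subseteq> above n (shift_down t zs)" for zs u
  proof -
    have "sorted (shift_down t zs @ indices u)"
      using that by (auto simp: sorted_append sorted_indices above_def prefix_min_def
          intro!: sorted_shift_down spread_T)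
    then show ?thesis
      using indices_mon_of by fastforce
  qed
  have T: "xs \<in> T" "ys \<in> T"
    using assms(1,2) by (auto simp: prefix_min_def)
  have "shift_down t xs @ indices v = shift_down t ys @ indices w"
    using ind[of xs v] ind[of ys w] assms by simp
  then have "take (length xs) (shift_down t xs @ indices v)
      = take (length xs) (shift_down t ys @ indices w)"
    by (rule arg_cong)
  then have "shift_down t xs = take (length xs) (shift_down t ys)"
    using assms(3) by simp
  then have "shift_up t (shift_down t xs) = take (length xs) (shift_up t (shift_down t ys))"
    by (simp only: shift_up_take)
  then have eq: "xs = take (length xs) ys"
    by (simp only: shift_up_down spread_T T)
  have "\<forall>k. xs = take k ys \<longrightarrow> \<not> k < length ys"
    using assms(2) T(1) by (auto simp: prefix_min_def)
  then have "\<not> length xs < length ys"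
    using eq by blast
  then have "take (length xs) ys = ys"
    by simp
  with eq show ?thesis
    by (rule trans)
qed

text \<open>The pieces \<open>A xs\<close> cover the left set, while the pieces \<open>B xs\<close>
  are disjoint subsets of the right one, and \<open>card_allowed_le\<close> compares them one by
  one. The degree bound makes everything finite.\<close>

lemma card_up_le:
  "card {w \<in> up n (mon_of ` T). mdeg w \<le> D}
    \<le> card {w \<in> up n (mon_of ` shift_down t ` T). mdeg w \<le> D}"
proof -
  define P where "P = {xs\<in>prefix_min. length xs \<le> D}"
  define A where "A xs = (+) (mon_of xs) ` mons_le (allowed t n xs) (D - length xs)" for xs
  define B where "B xs = (+) (mon_of (shift_down t xs)) `
    mons_le (above n (shift_down t xs)) (D - length xs)" for xs
  have finP: "finite P" and PT: "P \<subseteq> T"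
    using finite_T by (auto simp: P_def prefix_min_def)
  have "{w \<in> up n (mon_of ` T). mdeg w \<le> D} \<subseteq> (\<Union>xs\<in>P. A xs)"
  proof
    fix w assume "w \<in> {w \<in> up n (mon_of ` T). mdeg w \<le> D}"
    with up_cover obtain xs y where
      "xs \<in> prefix_min" "keys y \<subseteq> allowed t n xs" "w = mon_of xs + y" "mdeg w \<le> D"
      by blast
    then show "w \<in> (\<Union>xs\<in>P. A xs)"
      by (intro UN_I[of xs]) (auto simp: P_def A_def mons_le_def)
  qed
  then have "card {w \<in> up n (mon_of ` T). mdeg w \<le> D} \<le> card (\<Union>xs\<in>P. A xs)"
    using finP by (intro card_mono) (auto simp: A_def intro!: finite_mons_le)
  also have "\<dots> \<le> (\<Sum>xs\<in>P. card (A xs))"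
    using finP by (rule card_UN_le)
  also have "\<dots> \<le> (\<Sum>xs\<in>P. card (B xs))"
  proof (rule sum_mono)
    fix xs assume "xs \<in> P"
    then have "xs \<in> T" using PT by blast
    then show "card (A xs) \<le> card (B xs)"
      using card_mons_le_mono[OF finite_allowed finite_above card_allowed_le[OF spread_T bound_T]]
      by (simp add: A_def B_def card_image)
  qed
  also have "\<dots> = card (\<Union>xs\<in>P. B xs)"
  proof (rule card_UN_disjoint[symmetric])
    show "\<forall>xs\<in>P. \<forall>ys\<in>P. xs \<noteq> ys \<longrightarrow> B xs \<inter> B ys = {}"
    proof (intro ballI impI equals0I)
      fix xs ys z assume *: "xs \<in> P" "ys \<in> P" "xs \<noteq> ys" "z \<in> B xs \<inter> B ys"
      then obtain v w where
        "keys v \<subseteq> above n (shift_down t xs)" "keys w \<subseteq> above n (shift_down t ys)"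
        "z = mon_of (shift_down t xs) + v" "z = mon_of (shift_down t ys) + w"
        by (auto simp: B_def mons_le_def)
      moreover have "xs \<in> prefix_min" "ys \<in> prefix_min"
        using * by (auto simp: P_def)
      ultimately show False
        using prefix_min_shift_down_disjoint[of xs ys v w]
          prefix_min_shift_down_disjoint[of ys xs w v] *(3) by (cases "length xs \<le> length ys") auto
    qed
  qed (use finP in \<open>auto simp: B_def intro!: finite_mons_le\<close>)
  also have "\<dots> \<le> card {w \<in> up n (mon_of ` shift_down t ` T). mdeg w \<le> D}"
  proof (rule card_mono)
    have "up n (mon_of ` shift_down t ` T) \<subseteq> mons n"
      using shift_down_set_less[OF bound_T] by (intro up_subset_mons) (auto simp: mon_of_in_mons)
    then show "finite {w \<in> up n (mon_of ` shift_down t ` T). mdeg w \<le> D}"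
      by (intro finite_subset[OF _ finite_mons_le[of "{..<n}" D]]) (auto simp: mons_le_def mons_def)
    show "(\<Union>xs\<in>P. B xs) \<subseteq> {w \<in> up n (mon_of ` shift_down t ` T). mdeg w \<le> D}"
    proof
      fix z assume "z \<in> (\<Union>xs\<in>P. B xs)"
      then obtain xs y where xy: "xs \<in> P" "keys y \<subseteq> above n (shift_down t xs)"
          "mdeg y \<le> D - length xs" "z = mon_of (shift_down t xs) + y"
        by (auto simp: B_def mons_le_def)
      then have "y \<in> mons n" "mdeg z \<le> D"
        by (auto simp: mons_def above_def P_def)
      then show "z \<in> {w \<in> up n (mon_of ` shift_down t ` T). mdeg w \<le> D}"
        using xy(1,4) PT unfolding up_def by blast
    qed
  qed
  finally show ?thesis .
qed

end

subsection \<open>Polynomials supported on a set of monomials\<close>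

definition polys :: "mon set \<Rightarrow> 'a::field pol set" where
  "polys A = {p. keys p \<subseteq> A}"

abbreviation const :: "'a::field \<Rightarrow> 'a pol" where
  "const a \<equiv> Poly_Mapping.single 0 a"

lemma polys_0 [simp]: "0 \<in> polys A"
  by (simp add: polys_def)

lemma polys_add: "p \<in> polys A \<Longrightarrow> q \<in> polys A \<Longrightarrow> p + q \<in> polys A"
  using Poly_Mapping.keys_add[of p q] by (auto simp: polys_def)

lemma polys_uminus: "p \<in> polys A \<Longrightarrow> - p \<in> polys A"
  by (auto simp: polys_def in_keys_iff)

lemma polys_mult:
  assumes "p \<in> polys A" "q \<in> polys B" "\<And>a b. a \<in> A \<Longrightarrow> b \<in> B \<Longrightarrow> a + b \<in> C"
  shows "p * q \<in> polys C"
  using keys_mult[of p q] assms unfolding polys_def by blast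

lemma polys_sum: "(\<And>i. i \<in> I \<Longrightarrow> f i \<in> polys A) \<Longrightarrow> (\<Sum>i\<in>I. f i) \<in> polys A"
  by (induction I rule: infinite_finite_induct) (auto intro: polys_add)

lemma single_in_polys: "u \<in> A \<Longrightarrow> Poly_Mapping.single u a \<in> polys A"
  by (simp add: polys_def)

lemma polys_mono: "A \<subseteq> B \<Longrightarrow> polys A \<subseteq> polys B"
  by (auto simp: polys_def)

lemma polys_subset_iff: "(polys A :: 'a::field pol set) \<subseteq> polys B \<longleftrightarrow> A \<subseteq> B"
proof
  assume *: "(polys A :: 'a pol set) \<subseteq> polys B"
  show "A \<subseteq> B"
  proof
    fix u assume "u \<in> A"
    then have "(mon_pol u :: 'a pol) \<in> polys B"
      using * single_in_polys by blast
    then show "u \<in> B" by (simp add: polys_def)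
  qed
qed (rule polys_mono)

lemma polys_eq_iff: "(polys A :: 'a::field pol set) = polys B \<longleftrightarrow> A = B"
  using polys_subset_iff by (metis order.antisym order_refl)

lemma mon_pol_in_polys_iff: "(mon_pol u :: 'a::field pol) \<in> polys A \<longleftrightarrow> u \<in> A"
  by (simp add: polys_def)

lemma ring_S: "ring (S n :: 'a::field pol ring)"
proof (intro ringI abelian_groupI monoidI)
  fix x :: "'a pol" assume "x \<in> carrier (S n)"
  then show "\<exists>y\<in>carrier (S n). y \<oplus>\<^bsub>S n\<^esub> x = \<zero>\<^bsub>S n\<^esub>"
    by (intro bexI[of _ "- x"]) (auto simp: S_def in_keys_iff subset_iff)
next
  fix x y :: "'a pol" assume "x \<in> carrier (S n)" "y \<in> carrier (S n)"
  then have "x \<in> polys (mons n)" "y \<in> polys (mons n)"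
    by (simp_all add: S_def polys_def)
  then have "x + y \<in> polys (mons n)" "x * y \<in> polys (mons n)"
    by (auto intro: polys_add polys_mult)
  then show "x \<oplus>\<^bsub>S n\<^esub> y \<in> carrier (S n)" "x \<otimes>\<^bsub>S n\<^esub> y \<in> carrier (S n)"
    by (simp_all add: S_def polys_def)
qed (auto simp: S_def algebra_simps)

lemma carrier_S: "carrier (S n) = polys (mons n)"
  by (simp add: S_def polys_def)

lemma ideal_polys_up:
  assumes "M \<subseteq> mons n"
  shows "ideal (polys (up n M) :: 'a::field pol set) (S n)"
proof (intro idealI ring_S subgroup.intro)
  show "polys (up n M) \<subseteq> carrier (add_monoid (S n :: 'a pol ring))"
    using polys_mono[OF up_subset_mons[OF assms]] by (simp add: S_def polys_def)
next
  fix x :: "'a pol" assume x: "x \<in> polys (up n M)"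
  interpret ring "S n :: 'a pol ring" by (rule ring_S)
  have "- x \<in> polys (up n M)" "x \<in> carrier (S n)" "- x \<in> carrier (S n)"
    using x polys_mono[OF up_subset_mons[OF assms]] by (auto simp: carrier_S intro!: polys_uminus)
  moreover have "- x \<oplus>\<^bsub>S n\<^esub> x = \<zero>\<^bsub>S n\<^esub>"
    by (simp add: S_def)
  ultimately have "\<ominus>\<^bsub>S n\<^esub> x = - x"
    using minus_equality by blast
  then show "inv\<^bsub>add_monoid (S n)\<^esub> x \<in> polys (up n M)"
    using \<open>- x \<in> polys (up n M)\<close> by (simp add: a_inv_def)
next
  fix a x :: "'a pol" assume "a \<in> polys (up n M)" "x \<in> carrier (S n)"
  then have "a * x \<in> polys (up n M)"
    by (auto simp: carrier_S intro!: polys_mult[of _ "up n M" _ "mons n"] up_add)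
  then show "x \<otimes>\<^bsub>S n\<^esub> a \<in> polys (up n M)" "a \<otimes>\<^bsub>S n\<^esub> x \<in> polys (up n M)"
    by (simp_all add: S_def mult.commute)
qed (auto simp: S_def intro: polys_add)

text \<open>This reduces monomial ideals to their sets of monomials: equality and membership become
  statements about \<open>up n M\<close>.\<close>

lemma mon_ideal_eq:
  assumes "M \<subseteq> mons n"
  shows "(mon_ideal n M :: 'a::field pol set) = polys (up n M)"
proof
  interpret ring "S n :: 'a pol ring" by (rule ring_S)
  have M: "mon_pol ` M \<subseteq> (polys (up n M) :: 'a pol set)"
    using subset_up[of M n] by (auto intro!: single_in_polys)
  show "(mon_ideal n M :: 'a pol set) \<subseteq> polys (up n M)"
    unfolding mon_ideal_def by (rule genideal_minimal[OF ideal_polys_up[OF assms] M])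
  have "mon_pol ` M \<subseteq> carrier (S n :: 'a pol ring)"
    using assms by (auto simp: carrier_S intro!: single_in_polys)
  then have id: "ideal (mon_ideal n M :: 'a pol set) (S n)" and
      gen: "mon_pol ` M \<subseteq> (mon_ideal n M :: 'a pol set)"
    unfolding mon_ideal_def by (auto intro: genideal_ideal genideal_self[THEN subsetD])
  interpret J: ideal "mon_ideal n M :: 'a pol set" "S n" by (rule id)
  show "(polys (up n M) :: 'a pol set) \<subseteq> mon_ideal n M"
  proof
    fix p :: "'a pol" assume p: "p \<in> polys (up n M)"
    have "(\<Sum>u\<in>A. Poly_Mapping.single u (lookup p u)) \<in> mon_ideal n M" if "finite A" "A \<subseteq> up n M" for A
      using that
    proof (induction A rule: finite_induct)
      case empty
      then show ?case using J.zero_closed by (simp add: S_def)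
    next
      case (insert u A)
      then obtain m v where u: "m \<in> M" "v \<in> mons n" "u = m + v"
        by (auto simp: up_def)
      have "mon_pol m \<otimes>\<^bsub>S n\<^esub> Poly_Mapping.single v (lookup p u) \<in> mon_ideal n M"
        using gen u by (intro J.I_r_closed) (auto simp: carrier_S intro!: single_in_polys)
      then have "Poly_Mapping.single u (lookup p u) \<in> mon_ideal n M"
        by (simp add: S_def mult_single u(3))
      then show ?case
        using J.a_closed[of "Poly_Mapping.single u (lookup p u)"] insert by (simp add: S_def)
    qed
    from this[of "keys p"] p show "p \<in> mon_ideal n M"
      by (simp add: polys_def sum_single_lookup)
  qed
qed

section \<open>Minimal monomial generators\<close>

definition minimals :: "nat \<Rightarrow> mon set \<Rightarrow> mon set" where
  "minimals n M = {m \<in> up n M. \<forall>u\<in>up n M. \<forall>v\<in>mons n. m = u + v \<longrightarrow> u = m}"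

lemma minimals_subset: "minimals n M \<subseteq> M"
proof
  fix m assume m: "m \<in> minimals n M"
  then obtain u v where u: "u \<in> M" and v: "v \<in> mons n" "m = u + v"
    unfolding minimals_def up_def by blast
  have "u = m"
    using m u v subset_up[of M n] unfolding minimals_def by blast
  with u show "m \<in> M" by simp
qed

text \<open>Induction on the degree: a multiple that is not minimal has a proper divisor in
  \<open>up n M\<close>, which has smaller degree.\<close>

lemma up_minimals: "up n (minimals n M) = up n M"
proof
  have "minimals n M \<subseteq> up n M" by (auto simp: minimals_def)
  then show "up n (minimals n M) \<subseteq> up n M"
    using up_mono[of "minimals n M" "up n M" n] by simp
  have "u \<in> up n (minimals n M)" if "u \<in> up n M" for u
    using that
  proof (induction "mdeg u" arbitrary: u rule: less_induct)
    case less
    show ?case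
    proof (cases "u \<in> minimals n M")
      case True
      then show ?thesis using subset_up by blast
    next
      case False
      then obtain u' v where *: "u' \<in> up n M" "v \<in> mons n" "u = u' + v" "u' \<noteq> u"
        using less.prems by (auto simp: minimals_def)
      then have "v \<noteq> 0" by auto
      then have "mdeg u' < mdeg u"
        using *(3) mdeg_eq_0_iff[of v] by simp
      then show ?thesis
        using less.hyps[of u'] * up_add by blast
    qed
  qed
  then show "up n M \<subseteq> up n (minimals n M)" by blast
qed

lemma minimals_subset_of_up_eq: "up n N = up n M \<Longrightarrow> minimals n M \<subseteq> N"
  using minimals_subset[of n N] by (simp add: minimals_def)

text \<open>The set \<open>minimals n M\<close> depends on \<open>up n M\<close> only, so it
  generates the ideal and is contained in every generating set. This gives both the existence and
  the uniqueness demanded by the definite description.\<close>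

lemma G_polys_up:
  assumes "M \<subseteq> mons n"
  shows "G n (polys (up n M) :: 'a::field pol set) = minimals n M"
  unfolding G_def
proof (rule the_equality)
  have eq: "(mon_ideal n N :: 'a pol set) = polys (up n M) \<longleftrightarrow> up n N = up n M" if "N \<subseteq> mons n" for N
    using that by (simp add: mon_ideal_eq polys_eq_iff)
  have min: "minimals n M \<subseteq> mons n"
    using minimals_subset assms by blast
  show "minimals n M \<subseteq> mons n \<and> (mon_ideal n (minimals n M) :: 'a pol set) = polys (up n M) \<and>
    (\<forall>N\<subset>minimals n M. (mon_ideal n N :: 'a pol set) \<noteq> polys (up n M))"
  proof (intro conjI allI impI min notI)
    show "(mon_ideal n (minimals n M) :: 'a pol set) = polys (up n M)"
      using eq[OF min] up_minimals by simp
    fix N assume N: "N \<subset> minimals n M" "(mon_ideal n N :: 'a pol set) = polys (up n M)"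
    then have "N \<subseteq> mons n" using min by blast
    then have "minimals n M \<subseteq> N"
      using minimals_subset_of_up_eq eq N(2) by simp
    then show False using N(1) by blast
  qed
  fix N :: "mon set"
  assume N: "N \<subseteq> mons n \<and> (mon_ideal n N :: 'a pol set) = polys (up n M) \<and>
    (\<forall>N'\<subset>N. (mon_ideal n N' :: 'a pol set) \<noteq> polys (up n M))"
  then have "minimals n M \<subseteq> N"
    using eq[of N] minimals_subset_of_up_eq by simp
  moreover have "\<not> minimals n M \<subset> N"
    using N eq[OF min] up_minimals[of n M] by blast
  ultimately show "N = minimals n M"
    by blast
qed

subsection \<open>The reverse lexicographic order\<close>

lemma revlex_irrefl: "\<not> revlex_less u u"
  by (simp add: revlex_less_def)

lemma revlex_trans:
  assumes "revlex_less u v" "revlex_less v w"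
  shows "revlex_less u w"
proof (cases "mdeg u < mdeg w")
  case False
  then have eq: "mdeg u = mdeg v" "mdeg v = mdeg w"
    using assms by (auto simp: revlex_less_def)
  obtain k where k: "lookup v k < lookup u k" "\<And>i. i > k \<Longrightarrow> lookup u i = lookup v i"
    using assms(1) eq by (auto simp: revlex_less_def)
  obtain l where l: "lookup w l < lookup v l" "\<And>i. i > l \<Longrightarrow> lookup v i = lookup w i"
    using assms(2) eq by (auto simp: revlex_less_def)
  have "lookup w (max k l) < lookup u (max k l)"
    using k l by (cases k l rule: linorder_cases) (auto simp: max_def)
  moreover have "\<forall>i>max k l. lookup u i = lookup w i"
    using k l by simp
  ultimately show ?thesis
    using eq by (auto simp: revlex_less_def)
qed (simp add: revlex_less_def)

lemma revlex_total:
  assumes "u \<noteq> v"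
  shows "revlex_less u v \<or> revlex_less v u"
proof (cases "mdeg u = mdeg v")
  case True
  \<comment> \<open>Monomials of equal degree are compared at the largest index where they
    differ.\<close>
  define D where "D = {i. lookup u i \<noteq> lookup v i}"
  have "D \<subseteq> keys u \<union> keys v"
    by (auto simp: D_def in_keys_iff)
  then have fin: "finite D"
    by (rule finite_subset) simp
  have "D \<noteq> {}"
    using assms by (auto simp: D_def poly_mapping_eq_iff fun_eq_iff)
  define k where "k = Max D"
  have "k \<in> D"
    using fin \<open>D \<noteq> {}\<close> by (simp add: k_def)
  moreover have "lookup u i = lookup v i" if "i > k" for i
    using Max_ge[OF fin, of i] that by (force simp: k_def D_def)
  ultimately show ?thesis
    using True by (simp add: revlex_less_def D_def) (metis linorder_neqE_nat)
qed (auto simp: revlex_less_def)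

lemma revlex_add: "revlex_less u v \<Longrightarrow> revlex_less (u + y) (v + y)"
  by (auto simp: revlex_less_def lookup_add)

lemma finite_revlex_max:
  assumes "finite A" "A \<noteq> {}"
  shows "\<exists>u\<in>A. \<forall>v\<in>A. v \<noteq> u \<longrightarrow> revlex_less v u"
  using assms
proof (induction A rule: finite_ne_induct)
  case (insert x A)
  then obtain u where u: "u \<in> A" "\<forall>v\<in>A. v \<noteq> u \<longrightarrow> revlex_less v u" by blast
  then have "x \<noteq> u" using insert.hyps by blast
  then consider "revlex_less x u" | "revlex_less u x"
    using revlex_total by blast
  then show ?case
  proof cases
    case 2
    then have "revlex_less v x" if "v \<in> A" for v
      using u(2) that revlex_trans[of v u x] by (cases "v = u") auto
    then show ?thesis by blast
  qed (use u in auto)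
qed simp

lemma lead_mon_eqI:
  assumes "u \<in> keys f" "\<And>v. v \<in> keys f \<Longrightarrow> v \<noteq> u \<Longrightarrow> revlex_less v u"
  shows "lead_mon f = u"
  unfolding lead_mon_def
proof (rule the_equality)
  fix w assume w: "w \<in> keys f \<and> (\<forall>v\<in>keys f. v \<noteq> w \<longrightarrow> revlex_less v w)"
  show "w = u"
  proof (rule ccontr)
    assume "w \<noteq> u"
    then have "revlex_less w u" "revlex_less u w"
      using w assms by auto
    then show False
      using revlex_trans revlex_irrefl by blast
  qed
qed (use assms in blast)

lemma lead_mon:
  assumes "f \<noteq> 0"
  shows "lead_mon f \<in> keys f" "v \<in> keys f \<Longrightarrow> v \<noteq> lead_mon f \<Longrightarrow> revlex_less v (lead_mon f)"
proof -
  obtain u where "u \<in> keys f" "\<forall>v\<in>keys f. v \<noteq> u \<longrightarrow> revlex_less v u"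
    using finite_revlex_max[of "keys f"] assms by auto
  moreover from this have "lead_mon f = u"
    by (intro lead_mon_eqI) auto
  ultimately show "lead_mon f \<in> keys f" "v \<in> keys f \<Longrightarrow> v \<noteq> lead_mon f \<Longrightarrow> revlex_less v (lead_mon f)"
    by auto
qed

lemma lookup_times_single:
  "lookup (p * Poly_Mapping.single y (a :: 'a::field)) u = (\<Sum>m\<in>keys p. (lookup p m * a when m + y = u))"
proof -
  have "p * Poly_Mapping.single y a = (\<Sum>m\<in>keys p. Poly_Mapping.single (m + y) (lookup p m * a))"
    by (subst (1) sum_single_lookup[of p, symmetric]) (simp add: sum_distrib_right mult_single)
  then show ?thesis
    by (simp add: lookup_sum lookup_single)
qed

lemma lookup_times_mon_pol: "lookup (p * (mon_pol y :: 'a::field pol)) (m + y) = lookup p m"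
  by (simp add: lookup_times_single when_def sum.delta in_keys_iff)

lemma lookup_const_times [simp]: "lookup (const (a :: 'a::field) * p) m = a * lookup p m"
  using lookup_times_single[of p 0 a m]
  by (simp add: mult.commute[of _ p] when_def sum.delta in_keys_iff mult.commute)

lemma lead_mon_times_mon_pol:
  fixes f :: "'a::field pol"
  assumes "f \<noteq> 0"
  shows "f * mon_pol y \<noteq> 0" "lead_mon (f * mon_pol y) = lead_mon f + y"
proof -
  have key: "lead_mon f + y \<in> keys (f * mon_pol y)"
    using lead_mon(1)[OF assms] by (simp add: in_keys_iff lookup_times_mon_pol)
  then show "f * mon_pol y \<noteq> 0" by auto
  show "lead_mon (f * mon_pol y) = lead_mon f + y"
  proof (rule lead_mon_eqI[OF key])
    fix v assume v: "v \<in> keys (f * mon_pol y)" "v \<noteq> lead_mon f + y"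
    then obtain m where "m \<in> keys f" "v = m + y"
      using keys_mult[of f "mon_pol y"] by auto
    then show "revlex_less v (lead_mon f + y)"
      using v lead_mon(2)[OF assms, of m] by (auto intro: revlex_add)
  qed
qed

subsection \<open>Counting leading monomials\<close>

interpretation vs: vector_space "\<lambda>(a :: 'a::field) (p :: 'a pol). const a * p"
  by unfold_locales (simp_all add: algebra_simps single_add mult_single flip: mult.assoc)

lemma subspace_polys: "vs.subspace (polys A)"
  by (simp add: vs.subspace_def polys_add) (auto simp: polys_def in_keys_iff subset_iff)

text \<open>Choosing one polynomial of \<open>V\<close> for each leading monomial yields a basis:
  distinct leading monomials give independence, and successive cancellation of leading terms gives
  spanning.\<close>

lemma card_lead_mon:
  fixes V :: "'a::field pol set"
  assumes V: "vs.subspace V" "V \<subseteq> polys A" and A: "finite A"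
  shows "card (lead_mon ` (V - {0})) = vs.dim V"
proof -
  define L where "L = lead_mon ` (V - {0})"
  have LA: "L \<subseteq> A"
    using V(2) lead_mon(1) by (fastforce simp: L_def polys_def)
  then have finL: "finite L"
    using A finite_subset by blast
  have "\<forall>v\<in>L. \<exists>f. f \<in> V \<and> f \<noteq> 0 \<and> lead_mon f = v"
    by (auto simp: L_def)
  then obtain f where f: "f v \<in> V" "f v \<noteq> 0" "lead_mon (f v) = v" if "v \<in> L" for v
    by metis
  have inj: "inj_on f L"
    by (rule inj_onI) (metis f(3))
  have indep: "vs.independent (f ` L)"
  proof (rule vs.independent_if_scalars_zero)
    fix c x assume 0: "(\<Sum>x\<in>f ` L. const (c x) * x) = 0" and "x \<in> f ` L"
    show "c x = 0"
    proof (rule ccontr)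
      assume "c x \<noteq> 0"
      \<comment> \<open>Let u be the largest leading monomial used with a nonzero scalar. Only
        \<open>f u\<close> contributes to the coefficient of u, so the sum cannot vanish.\<close>
      define N where "N = {v\<in>L. c (f v) \<noteq> 0}"
      have "finite N" "N \<noteq> {}"
        using finL \<open>c x \<noteq> 0\<close> \<open>x \<in> f ` L\<close> by (auto simp: N_def)
      then obtain u where u: "u \<in> N" "\<forall>v\<in>N. v \<noteq> u \<longrightarrow> revlex_less v u"
        using finite_revlex_max by blast
      have "c (f v) * lookup (f v) u = 0" if "v \<in> L" "v \<noteq> u" for v
      proof (rule ccontr)
        assume *: "c (f v) * lookup (f v) u \<noteq> 0"
        then have "v \<in> N" "u \<in> keys (f v)"
          using that by (auto simp: N_def in_keys_iff)
        then have "revlex_less u v" "revlex_less v u"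
          using lead_mon(2)[of "f v" u] f[OF that(1)] u(2) that(2) by auto
        then show False
          using revlex_trans revlex_irrefl by blast
      qed
      then have "(\<Sum>v\<in>L. c (f v) * lookup (f v) u) = (\<Sum>v\<in>{u}. c (f v) * lookup (f v) u)"
        using u(1) finL by (intro sum.mono_neutral_right) (auto simp: N_def)
      moreover have "(\<Sum>v\<in>L. c (f v) * lookup (f v) u) = lookup (\<Sum>x\<in>f ` L. const (c x) * x) u"
        by (simp add: sum.reindex[OF inj] lookup_sum)
      moreover have "lookup (f u) u \<noteq> 0"
        using lead_mon(1)[of "f u"] f[of u] u(1) by (auto simp: N_def in_keys_iff)
      ultimately show False
        using 0 u(1) by (simp add: N_def)
    qed
  qed (use finL in simp)
  \<comment> \<open>Cancelling the leading term against \<open>f v\<close> lowers the leading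
    monomial. The induction counts the monomials of the finite set \<open>A\<close> below it, which
    makes the reduction terminate.\<close>
  have span: "p \<in> vs.span (f ` L)" if "p \<in> V" for p
    using that
  proof (induction "card {u\<in>A. revlex_less u (lead_mon p)}" arbitrary: p rule: less_induct)
    case less
    show ?case
    proof (cases "p = 0")
      case False
      define v where "v = lead_mon p"
      have v: "v \<in> L" using less.prems False by (auto simp: L_def v_def)
      define a where "a = lookup p v / lookup (f v) v"
      define q where "q = p - const a * f v"
      have "q \<in> V"
        using less.prems f(1)[OF v] V(1) by (simp add: q_def vs.subspace_diff vs.subspace_scale)
      have lc: "lookup (f v) v \<noteq> 0"
        using lead_mon(1)[of "f v"] f[OF v] by (auto simp: in_keys_iff)
      have q_less: "revlex_less u v" if "u \<in> keys q" for u
      proof -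
        have "u \<noteq> v"
          using that lc by (auto simp: q_def in_keys_iff lookup_minus a_def)
        moreover have "u \<in> keys p \<or> u \<in> keys (f v)"
          using that by (auto simp: q_def in_keys_iff lookup_minus)
        ultimately show ?thesis
          using lead_mon(2)[of p u] lead_mon(2)[of "f v" u] f[OF v] False by (auto simp: v_def)
      qed
      have "q \<in> vs.span (f ` L)"
      proof (cases "q = 0")
        case False
        have lq: "lead_mon q \<in> A" "revlex_less (lead_mon q) v"
          using lead_mon(1)[OF False] q_less \<open>q \<in> V\<close> V(2) by (auto simp: polys_def)
        have "{u\<in>A. revlex_less u (lead_mon q)} \<subset> {u\<in>A. revlex_less u v}"
          using lq revlex_trans revlex_irrefl by blast
        then show ?thesis
          using less.hyps[of q] \<open>q \<in> V\<close> A by (simp add: v_def psubset_card_mono)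
      qed (simp add: vs.span_zero)
      moreover have "const a * f v \<in> vs.span (f ` L)"
        using v by (intro vs.span_scale vs.span_base) auto
      moreover have "p = q + const a * f v" by (simp add: q_def)
      ultimately show ?thesis
        by (metis vs.span_add)
    qed (simp add: vs.span_zero)
  qed
  have "card (f ` L) = vs.dim V"
    using f(1) span indep by (intro vs.basis_card_eq_dim) auto
  then show ?thesis
    by (simp add: card_image[OF inj] flip: L_def)
qed

subsection \<open>Substitution\<close>

declare One_nat_def [simp del] \<comment> \<open>keeps \<open>var i\<close> folded\<close>

definition eval_mon :: "('v \<Rightarrow> 'b::comm_semiring_1) \<Rightarrow> ('v \<Rightarrow>\<^sub>0 nat) \<Rightarrow> 'b" where
  "eval_mon x m = (\<Prod>v\<in>keys m. x v ^ lookup m v)"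

lemma eval_mon_superset:
  "finite A \<Longrightarrow> keys m \<subseteq> A \<Longrightarrow> eval_mon x m = (\<Prod>v\<in>A. x v ^ lookup m v)"
  unfolding eval_mon_def by (rule prod.mono_neutral_left) (auto simp: in_keys_iff)

lemma eval_mon_0 [simp]: "eval_mon x 0 = 1"
  by (simp add: eval_mon_def)

lemma eval_mon_single [simp]: "eval_mon x (Poly_Mapping.single v k) = x v ^ k"
  by (simp add: eval_mon_def)

lemma eval_mon_add: "eval_mon x (m + m') = eval_mon x m * eval_mon x m'"
proof -
  have keys: "keys (m + m') \<subseteq> keys m \<union> keys m'"
    by (rule Poly_Mapping.keys_add)
  have "eval_mon x w = (\<Prod>v\<in>keys m \<union> keys m'. x v ^ lookup w v)" if "w \<in> {m, m', m + m'}" for w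
    by (rule eval_mon_superset) (use that keys in auto)
  then show ?thesis
    by (simp add: lookup_add power_add prod.distrib)
qed

text \<open>Two coefficient maps occur: the identity, for evaluating polynomials at matrix entries,
  and the embedding of constants, for \<open>gl_act\<close>.\<close>

locale coeff_hom =
  fixes c :: "'a::comm_semiring_1 \<Rightarrow> 'b::comm_semiring_1"
  assumes c_0: "c 0 = 0" and c_1: "c 1 = 1"
    and c_add: "c (a + b) = c a + c b" and c_mult: "c (a * b) = c a * c b"
begin

lemma subst_pol_superset:
  "finite A \<Longrightarrow> keys p \<subseteq> A \<Longrightarrow> subst_pol c x p = (\<Sum>m\<in>A. c (lookup p m) * eval_mon x m)"
  unfolding subst_pol_def eval_mon_def
  by (rule sum.mono_neutral_left) (auto simp: in_keys_iff c_0)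

lemma subst_pol_0 [simp]: "subst_pol c x 0 = 0"
  by (simp add: subst_pol_def)

lemma subst_pol_single: "subst_pol c x (Poly_Mapping.single m a) = c a * eval_mon x m"
  by (subst subst_pol_superset[of "{m}"]) auto

lemma subst_pol_add: "subst_pol c x (p + q) = subst_pol c x p + subst_pol c x q"
proof -
  have keys: "keys (p + q) \<subseteq> keys p \<union> keys q"
    by (rule Poly_Mapping.keys_add)
  have "subst_pol c x r = (\<Sum>m\<in>keys p \<union> keys q. c (lookup r m) * eval_mon x m)"
    if "r \<in> {p, q, p + q}" for r
    by (rule subst_pol_superset) (use that keys in auto)
  then show ?thesis
    by (simp add: lookup_add c_add distrib_right sum.distrib)
qed

lemma subst_pol_sum: "subst_pol c x (\<Sum>i\<in>I. f i) = (\<Sum>i\<in>I. subst_pol c x (f i))"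
  by (induction I rule: infinite_finite_induct) (simp_all add: subst_pol_add)

lemma subst_pol_mult: "subst_pol c x (p * q) = subst_pol c x p * subst_pol c x q"
proof -
  have "subst_pol c x (Poly_Mapping.single m a * Poly_Mapping.single m' b)
      = subst_pol c x (Poly_Mapping.single m a) * subst_pol c x (Poly_Mapping.single m' b)"
    for m a m' b
    by (simp add: mult_single subst_pol_single c_mult eval_mon_add ac_simps)
  then have "subst_pol c x ((\<Sum>m\<in>keys p. Poly_Mapping.single m (lookup p m))
        * (\<Sum>m\<in>keys q. Poly_Mapping.single m (lookup q m)))
      = subst_pol c x (\<Sum>m\<in>keys p. Poly_Mapping.single m (lookup p m))
        * subst_pol c x (\<Sum>m\<in>keys q. Poly_Mapping.single m (lookup q m))"
    by (simp add: subst_pol_sum sum_distrib_left sum_distrib_right)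
  then show ?thesis
    by (simp only: sum_single_lookup)
qed

lemma subst_pol_1 [simp]: "subst_pol c x 1 = 1"
  using subst_pol_single[of x 0 1] by (simp add: c_1)

end

interpretation id_hom: coeff_hom "id :: 'a::field \<Rightarrow> 'a"
  by unfold_locales simp_all

interpretation const_hom: coeff_hom "Poly_Mapping.single 0 :: 'a::field \<Rightarrow> 'a pol"
  by unfold_locales (simp_all add: single_add mult_single)

subsection \<open>Linear changes of coordinates\<close>

definition linear_form :: "nat \<Rightarrow> 'a::field mat \<Rightarrow> nat \<Rightarrow> 'a pol" where
  "linear_form n g j = (\<Sum>i<n. Poly_Mapping.single (var i) (g $$ (i, j)))"

lemma gl_act_eq: "gl_act n g = subst_pol (Poly_Mapping.single 0) (linear_form n g)"
  by (simp add: gl_act_def linear_form_def[abs_def])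

lemmas gl_act_0 [simp] = const_hom.subst_pol_0[of "linear_form n g" for n g, folded gl_act_eq]
lemmas gl_act_1 [simp] = const_hom.subst_pol_1[of "linear_form n g" for n g, folded gl_act_eq]
lemmas gl_act_add = const_hom.subst_pol_add[of "linear_form n g" for n g, folded gl_act_eq]
lemmas gl_act_mult = const_hom.subst_pol_mult[of "linear_form n g" for n g, folded gl_act_eq]
lemmas gl_act_sum = const_hom.subst_pol_sum[of "linear_form n g" for n g, folded gl_act_eq]

lemma gl_act_const [simp]: "gl_act n g (const a) = const a"
  by (simp add: gl_act_eq const_hom.subst_pol_single)

lemma gl_act_uminus: "gl_act n g (- p) = - gl_act n g p"
proof -
  have "gl_act n g p + gl_act n g (- p) = 0"
    by (simp flip: gl_act_add)
  then show ?thesis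
    by (simp add: eq_neg_iff_add_eq_0 add.commute)
qed

lemma gl_act_diff: "gl_act n g (p - q) = gl_act n g p - gl_act n g q"
  using gl_act_add[of n g p "- q"] by (simp add: gl_act_uminus)

lemma gl_act_mon_of: "gl_act n g (mon_pol (mon_of xs)) = prod_list (map (linear_form n g) xs)"
proof -
  have "eval_mon x (mon_of xs) = prod_list (map x xs)" for x :: "nat \<Rightarrow> 'a pol"
    by (induction xs) (simp_all add: eval_mon_add)
  then show ?thesis
    by (simp add: gl_act_eq const_hom.subst_pol_single)
qed

lemma gl_act_var: "gl_act n g (mon_pol (var j)) = linear_form n g j"
  using gl_act_mon_of[of n g "[j]"] by simp

lemma mon_pol_mon_of: "(mon_pol (mon_of xs) :: 'a::field pol) = prod_list (map (\<lambda>i. mon_pol (var i)) xs)"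
proof (induction xs)
  case (Cons x xs)
  have "mon_pol (mon_of (x # xs)) = mon_pol (var x) * (mon_pol (mon_of xs) :: 'a pol)"
    by (simp add: mult_single)
  with Cons show ?case by simp
qed simp

lemma single_eq_const_times: "Poly_Mapping.single m a = const a * mon_pol m"
  by (simp add: mult_single)

lemma polys_const_times: "p \<in> polys A \<Longrightarrow> const a * p \<in> polys A"
  by (rule vs.subspace_scale[OF subspace_polys])

lemma gl_act_linear_form:
  assumes "g \<in> carrier_mat n n" "h \<in> carrier_mat n n" "j < n"
  shows "(\<Sum>i<n. const (g $$ (i, j)) * linear_form n h i) = linear_form n (h * g) j"
proof -
  have "(\<Sum>i<n. const (g $$ (i, j)) * linear_form n h i)
      = (\<Sum>k<n. \<Sum>i<n. Poly_Mapping.single (var k) (h $$ (k, i) * g $$ (i, j)))"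
    unfolding linear_form_def sum_distrib_left mult_single
    by (subst sum.swap) (simp add: mult.commute)
  also have "\<dots> = (\<Sum>k<n. Poly_Mapping.single (var k) (\<Sum>i<n. h $$ (k, i) * g $$ (i, j)))"
  proof -
    have "(\<Sum>i\<in>I. Poly_Mapping.single u (f i)) = Poly_Mapping.single u (\<Sum>i\<in>I. f i)"
      if "finite I" for I :: "nat set" and u :: mon and f :: "nat \<Rightarrow> 'a"
      using that by (induction I) (simp_all add: single_add)
    then show ?thesis by simp
  qed
  also have "\<dots> = linear_form n (h * g) j"
    unfolding linear_form_def using assms
    by (intro sum.cong refl arg_cong2[where f = Poly_Mapping.single])
       (auto simp: scalar_prod_def atLeast0LessThan)
  finally show ?thesis .
qed

text \<open>Algebra homomorphisms are determined by the images of the variables. The maps are left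
  abstract so that composites and the identity are covered.\<close>

lemma gl_act_eqI:
  assumes "p \<in> polys (mons n)" "\<And>j. j < n \<Longrightarrow> \<phi> (mon_pol (var j)) = \<psi> (mon_pol (var j))"
    and add: "\<And>p q. \<phi> (p + q) = \<phi> p + \<phi> q" "\<And>p q. \<psi> (p + q) = \<psi> p + \<psi> q"
    and mult: "\<And>p q. \<phi> (p * q) = \<phi> p * \<phi> q" "\<And>p q. \<psi> (p * q) = \<psi> p * \<psi> q"
    and const: "\<And>a. \<phi> (const a) = const a" "\<And>a. \<psi> (const a) = const a"
  shows "\<phi> (p :: 'a::field pol) = (\<psi> p :: 'a pol)"
proof -
  have one: "\<phi> 1 = 1" "\<psi> 1 = 1" and zero: "\<phi> 0 = 0" "\<psi> 0 = 0"
    using const[of 1] const[of 0] by simp_all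
  have mon: "\<phi> (mon_pol (mon_of xs)) = \<psi> (mon_pol (mon_of xs))" if "set xs \<subseteq> {..<n}" for xs
    using that unfolding mon_pol_mon_of by (induction xs) (simp_all add: one mult assms(2))
  have single: "\<phi> (Poly_Mapping.single m a) = \<psi> (Poly_Mapping.single m a)" if "m \<in> mons n" for m a
    using mon[of "indices m"] that
    by (subst (1 2) single_eq_const_times) (simp add: mult const mons_def)
  have "\<phi> (\<Sum>m\<in>A. Poly_Mapping.single m (lookup p m)) = \<psi> (\<Sum>m\<in>A. Poly_Mapping.single m (lookup p m))"
    if "finite A" "A \<subseteq> mons n" for A
    using that by (induction A) (simp_all add: zero add single)
  from this[of "keys p"] assms(1) show ?thesis
    by (simp add: sum_single_lookup polys_def)
qed

text \<open>Column j of the matrix holds the coefficients of the image of variable j, so a later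
  substitution multiplies on the left.\<close>

lemma gl_act_gl_act:
  assumes "g \<in> carrier_mat n n" "h \<in> carrier_mat n n" "p \<in> polys (mons n)"
  shows "gl_act n h (gl_act n g p) = gl_act n (h * g) p"
proof (rule gl_act_eqI[OF assms(3)])
  fix j assume "j < n"
  have "gl_act n h (Poly_Mapping.single (var i) a) = const a * linear_form n h i" for i a
    by (subst single_eq_const_times) (simp add: gl_act_mult gl_act_var)
  then have "gl_act n h (linear_form n g j) = (\<Sum>i<n. const (g $$ (i, j)) * linear_form n h i)"
    by (simp add: linear_form_def[of n g] gl_act_sum)
  then show "gl_act n h (gl_act n g (mon_pol (var j))) = gl_act n (h * g) (mon_pol (var j))"
    using gl_act_linear_form[OF assms(1,2) \<open>j < n\<close>] by (simp add: gl_act_var)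
qed (simp_all add: gl_act_add gl_act_mult)

lemma linear_form_one: "j < n \<Longrightarrow> linear_form n (1\<^sub>m n) j = mon_pol (var j)"
proof -
  assume j: "j < n"
  have "linear_form n (1\<^sub>m n) j = (\<Sum>i<n. if i = j then mon_pol (var j) else 0)"
    unfolding linear_form_def using j by (intro sum.cong) auto
  then show ?thesis using j by simp
qed

lemma gl_act_one: "p \<in> polys (mons n) \<Longrightarrow> gl_act n (1\<^sub>m n) p = p"
proof (erule gl_act_eqI)
  fix j assume "j < n"
  then show "gl_act n (1\<^sub>m n) (mon_pol (var j)) = mon_pol (var j)"
    unfolding gl_act_var by (rule linear_form_one)
qed (simp_all add: gl_act_add gl_act_mult)

definition mons_eq :: "nat \<Rightarrow> nat \<Rightarrow> mon set" where
  "mons_eq n k = {u\<in>mons n. mdeg u = k}"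

lemma linear_form_in_polys: "linear_form n g j \<in> polys (mons_eq n 1)"
  unfolding linear_form_def by (intro polys_sum single_in_polys) (simp add: mons_eq_def)

lemma polys_mons_eq_mult:
  "p \<in> polys (mons_eq n k) \<Longrightarrow> q \<in> polys (mons_eq n l) \<Longrightarrow> p * q \<in> polys (mons_eq n (k + l))"
  by (erule polys_mult) (auto simp: mons_eq_def)

lemma gl_act_mon_pol_in_polys: "gl_act n g (mon_pol u) \<in> polys (mons_eq n (mdeg u))"
proof -
  have "prod_list (map (linear_form n g) xs) \<in> polys (mons_eq n (length xs))" for xs
  proof (induction xs)
    case (Cons x xs)
    then show ?case
      using polys_mons_eq_mult[OF linear_form_in_polys Cons.IH] by (simp add: plus_1_eq_Suc)
  qed (auto simp: mons_eq_def polys_def)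
  from this[of "indices u"] show ?thesis
    using gl_act_mon_of[of n g "indices u"] by simp
qed

lemma gl_act_decompose:
  "gl_act n g p = (\<Sum>m\<in>keys p. const (lookup p m) * gl_act n g (mon_pol m))"
proof -
  have single: "gl_act n g (Poly_Mapping.single m a) = const a * gl_act n g (mon_pol m)" for m a
    by (subst single_eq_const_times) (simp add: gl_act_mult)
  have "gl_act n g p = (\<Sum>m\<in>keys p. gl_act n g (Poly_Mapping.single m (lookup p m)))"
    by (simp only: sum_single_lookup flip: gl_act_sum)
  also have "\<dots> = (\<Sum>m\<in>keys p. const (lookup p m) * gl_act n g (mon_pol m))"
    by (intro sum.cong refl single)
  finally show ?thesis .
qed

lemma gl_act_in_polys:
  assumes "\<And>u. u \<in> A \<Longrightarrow> mdeg u \<le> D" "p \<in> polys A"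
  shows "gl_act n g p \<in> polys {u\<in>mons n. mdeg u \<le> D}"
proof -
  have "polys (mons_eq n (mdeg m)) \<subseteq> polys {u\<in>mons n. mdeg u \<le> D}" if "m \<in> A" for m
    using assms(1)[OF that] by (intro polys_mono) (auto simp: mons_eq_def)
  then have "gl_act n g (mon_pol m) \<in> polys {u\<in>mons n. mdeg u \<le> D}" if "m \<in> keys p" for m
    using gl_act_mon_pol_in_polys[of n g m] that assms(2) unfolding polys_def by blast
  then show ?thesis
    unfolding gl_act_decompose[of n g p] by (intro polys_sum polys_const_times)
qed

section \<open>Invertible matrices and injectivity of their action\<close>

lemma GL_inverse:
  fixes g :: "'a::field mat"
  assumes "g \<in> GL n"
  obtains h where "h \<in> carrier_mat n n" "g * h = 1\<^sub>m n" "h * g = 1\<^sub>m n"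
proof -
  have g: "g \<in> carrier_mat n n" using assms by (simp add: GL_def)
  obtain h where h: "g * h = 1\<^sub>m (dim_row g)" "h * g = 1\<^sub>m (dim_row h)"
    using assms by (auto simp: GL_def invertible_mat_def inverts_mat_def)
  have "dim_col (g * h) = n" "dim_col (h * g) = dim_row h"
    using h g by simp_all
  then have "h \<in> carrier_mat n n"
    using g by auto
  then show thesis
    using that[of h] h g by simp
qed

lemma GL_iff_det:
  fixes g :: "'a::field mat"
  shows "g \<in> GL n \<longleftrightarrow> g \<in> carrier_mat n n \<and> det g \<noteq> 0"
proof
  assume g: "g \<in> GL n"
  then obtain h where h: "h \<in> carrier_mat n n" "g * h = 1\<^sub>m n"
    using GL_inverse by blast
  have "g \<in> carrier_mat n n" using g by (simp add: GL_def)
  then have "det g * det h = 1"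
    using det_mult[of g n h] h by simp
  then show "g \<in> carrier_mat n n \<and> det g \<noteq> 0"
    using \<open>g \<in> carrier_mat n n\<close> by auto
next
  assume g: "g \<in> carrier_mat n n \<and> det g \<noteq> 0"
  then have "g \<in> Units (ring_mat TYPE('a) n ())"
    by (intro det_non_zero_imp_unit) auto
  then obtain h where "h \<in> carrier_mat n n" "h * g = 1\<^sub>m n" "g * h = 1\<^sub>m n"
    by (auto simp: Units_def ring_mat_def)
  then show "g \<in> GL n"
    using g by (auto simp: GL_def invertible_mat_def inverts_mat_def)
qed

lemma gl_act_inverse:
  assumes "g \<in> carrier_mat n n" "h \<in> carrier_mat n n" "h * g = 1\<^sub>m n" "p \<in> polys (mons n)"
  shows "gl_act n h (gl_act n g p) = p"
  using gl_act_gl_act[OF assms(1,2,4)] gl_act_one[OF assms(4)] assms(3) by simp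

lemma gl_act_eq_0_iff:
  assumes "g \<in> GL n" "p \<in> polys (mons n)"
  shows "gl_act n g p = 0 \<longleftrightarrow> p = 0"
proof
  assume *: "gl_act n g p = 0"
  obtain h where "h \<in> carrier_mat n n" "h * g = 1\<^sub>m n"
    using GL_inverse[OF assms(1)] by blast
  then have "gl_act n h (gl_act n g p) = p"
    using assms by (intro gl_act_inverse) (auto simp: GL_def)
  then show "p = 0" using * by simp
qed simp

section \<open>Leading monomials of the image of a space spanned by monomials\<close>

definition leads :: "nat \<Rightarrow> 'a::field mat \<Rightarrow> mon set \<Rightarrow> mon set" where
  "leads n g B = lead_mon ` (gl_act n g ` polys B - {0})"

lemma leads_mono: "A \<subseteq> B \<Longrightarrow> leads n g A \<subseteq> leads n g B"
  unfolding leads_def using polys_mono by blast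

lemma subspace_gl_act_polys: "vs.subspace (gl_act n g ` polys B)"
  unfolding vs.subspace_def
proof (intro conjI ballI allI)
  show "0 \<in> gl_act n g ` polys B" by (intro image_eqI[of _ _ 0]) auto
  fix x y assume "x \<in> gl_act n g ` polys B" "y \<in> gl_act n g ` polys B"
  then obtain p q where "p \<in> polys B" "q \<in> polys B" "x = gl_act n g p" "y = gl_act n g q" by blast
  then show "x + y \<in> gl_act n g ` polys B"
    by (intro image_eqI[of _ _ "p + q"]) (simp_all add: gl_act_add polys_add)
next
  fix a x assume "x \<in> gl_act n g ` polys B"
  then obtain p where "p \<in> polys B" "x = gl_act n g p" by blast
  then show "const a * x \<in> gl_act n g ` polys B"
    by (intro image_eqI[of _ _ "const a * p"]) (simp_all add: gl_act_mult polys_const_times)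
qed

text \<open>As g acts injectively, the images of the monomials in \<open>B\<close> form a basis of
  the image space, and the number of leading monomials is its dimension.\<close>

lemma card_leads:
  fixes g :: "'a::field mat"
  assumes g: "g \<in> GL n" and B: "B \<subseteq> mons n" "finite B"
  shows "card (leads n g B) = card B" "finite (leads n g B)" "leads n g B \<subseteq> mons n"
proof -
  let ?V = "gl_act n g ` polys B"
  have sub: "vs.subspace ?V"
    by (rule subspace_gl_act_polys)
  \<comment> \<open>Inserting 0 keeps the maximum meaningful when \<open>B\<close> is empty.\<close>
  define D where "D = Max (insert 0 (mdeg ` B))"
  have "mdeg u \<le> D" if "u \<in> B" for u
    using that B(2) by (simp add: D_def)
  then have V: "?V \<subseteq> polys {u\<in>mons n. mdeg u \<le> D}"
    using gl_act_in_polys by blast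
  have fin: "finite {u\<in>mons n. mdeg u \<le> D}"
    using finite_mons_le[of "{..<n}" D] by (simp add: mons_le_def mons_def)
  have "leads n g B \<subseteq> {u\<in>mons n. mdeg u \<le> D}"
    using V lead_mon(1) unfolding leads_def polys_def by blast
  then show "finite (leads n g B)" "leads n g B \<subseteq> mons n"
    using fin finite_subset by auto
  let ?b = "\<lambda>u. gl_act n g (mon_pol u) :: 'a pol"
  have lin: "(\<Sum>u\<in>A. const (f u) * ?b u) = gl_act n g (\<Sum>u\<in>A. const (f u) * mon_pol u)" for f A
    by (simp add: gl_act_sum gl_act_mult)
  have zero: "f u = 0" if "(\<Sum>u\<in>B. const (f u) * ?b u) = 0" "u \<in> B" for f u
  proof -
    have "(\<Sum>u\<in>B. const (f u) * mon_pol u) \<in> polys (mons n)"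
      using B(1) by (intro polys_sum polys_const_times single_in_polys) auto
    then have "(\<Sum>u\<in>B. const (f u) * mon_pol u) = 0"
      using that(1) gl_act_eq_0_iff[OF g] unfolding lin by blast
    then have "lookup (\<Sum>u\<in>B. const (f u) * mon_pol u) u = 0"
      by simp
    then show ?thesis
      using that(2) B(2) by (simp add: lookup_sum lookup_single when_def sum.delta' mult_single)
  qed
  have inj: "inj_on ?b B"
  proof (rule inj_onI, rule ccontr)
    fix u v assume *: "u \<in> B" "v \<in> B" "?b u = ?b v" "u \<noteq> v"
    have "gl_act n g (mon_pol u - mon_pol v) = 0"
      using *(3) by (simp add: gl_act_diff)
    moreover have "mon_pol u - mon_pol v \<in> (polys (mons n) :: 'a pol set)"
      using * B(1) by (intro vs.subspace_diff[OF subspace_polys] single_in_polys) auto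
    ultimately have "mon_pol u - mon_pol v = (0 :: 'a pol)"
      using gl_act_eq_0_iff[OF g] by blast
    then have "lookup (mon_pol u :: 'a pol) u = lookup (mon_pol v) u"
      by simp
    then show False
      using *(4) by (simp add: lookup_single)
  qed
  have "vs.independent (?b ` B)"
  proof (rule vs.independent_if_scalars_zero)
    fix f x assume "(\<Sum>x\<in>?b ` B. const (f x) * x) = 0" "x \<in> ?b ` B"
    then show "f x = 0"
      using zero[of "\<lambda>u. f (?b u)"] by (auto simp: sum.reindex[OF inj])
  qed (use B(2) in simp)
  moreover have "?V \<subseteq> vs.span (?b ` B)"
  proof
    fix x assume "x \<in> ?V"
    then obtain p where p: "p \<in> polys B" "x = gl_act n g p" by blast
    show "x \<in> vs.span (?b ` B)"
      unfolding p(2) gl_act_decompose[of n g p]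
      using p(1) by (intro vs.span_sum vs.span_scale vs.span_base) (auto simp: polys_def)
  qed
  moreover have "?b ` B \<subseteq> ?V"
    by (auto intro: single_in_polys)
  ultimately have "card (?b ` B) = vs.dim ?V"
    by (intro vs.basis_card_eq_dim)
  then show "card (leads n g B) = card B"
    using card_lead_mon[OF sub V fin] by (simp add: leads_def card_image[OF inj])
qed

subsection \<open>Regular functions on matrices\<close>

definition regular_pol :: "nat \<Rightarrow> ((nat \<times> nat \<Rightarrow>\<^sub>0 nat) \<Rightarrow>\<^sub>0 'a::field) \<Rightarrow> bool" where
  "regular_pol n f \<longleftrightarrow> (\<forall>m\<in>keys f. keys m \<subseteq> {..<n} \<times> {..<n})"

text \<open>Polynomial functions of the entries in the n by n range. Agreement is demanded for
  matrices of all dimensions, so the closure rules carry no dimension conditions.\<close>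

definition regular :: "nat \<Rightarrow> ('a::field mat \<Rightarrow> 'a) \<Rightarrow> bool" where
  "regular n \<phi> \<longleftrightarrow> (\<exists>f. regular_pol n f \<and> (\<forall>g. subst_pol id (\<lambda>e. g $$ e) f = \<phi> g))"

lemma regular_const: "regular n (\<lambda>_. a)"
  unfolding regular_def
  by (rule exI[of _ "Poly_Mapping.single 0 a"])
    (simp add: regular_pol_def id_hom.subst_pol_single)

lemma regular_entry:
  assumes "i < n" "j < n"
  shows "regular n (\<lambda>g. g $$ (i, j))"
  unfolding regular_def
  by (rule exI[of _ "Poly_Mapping.single (Poly_Mapping.single (i, j) 1) 1"])
    (use assms in \<open>simp add: regular_pol_def id_hom.subst_pol_single\<close>)

lemma regular_add:
  assumes "regular n \<phi>" "regular n \<psi>"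
  shows "regular n (\<lambda>g. \<phi> g + \<psi> g)"
proof -
  obtain f h where "regular_pol n f" "\<And>g. subst_pol id (\<lambda>e. g $$ e) f = \<phi> g"
      "regular_pol n h" "\<And>g. subst_pol id (\<lambda>e. g $$ e) h = \<psi> g"
    using assms unfolding regular_def by blast
  moreover from this have "regular_pol n (f + h)"
    using Poly_Mapping.keys_add[of f h] unfolding regular_pol_def by blast
  ultimately show ?thesis
    unfolding regular_def by (intro exI[of _ "f + h"]) (simp add: id_hom.subst_pol_add)
qed

lemma regular_mult:
  assumes "regular n \<phi>" "regular n \<psi>"
  shows "regular n (\<lambda>g. \<phi> g * \<psi> g)"
proof -
  obtain f h where fh: "regular_pol n f" "\<And>g. subst_pol id (\<lambda>e. g $$ e) f = \<phi> g"
      "regular_pol n h" "\<And>g. subst_pol id (\<lambda>e. g $$ e) h = \<psi> g"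
    using assms unfolding regular_def by blast
  have "regular_pol n (f * h)"
    unfolding regular_pol_def
  proof
    fix m assume "m \<in> keys (f * h)"
    then obtain a b where "a \<in> keys f" "b \<in> keys h" "m = a + b"
      using keys_mult[of f h] by blast
    then show "keys m \<subseteq> {..<n} \<times> {..<n}"
      using fh(1,3) Poly_Mapping.keys_add[of a b] unfolding regular_pol_def by blast
  qed
  then show ?thesis
    unfolding regular_def by (intro exI[of _ "f * h"]) (simp add: id_hom.subst_pol_mult fh)
qed

lemma regular_sum: "(\<And>i. i \<in> I \<Longrightarrow> regular n (\<phi> i)) \<Longrightarrow> regular n (\<lambda>g. \<Sum>i\<in>I. \<phi> i g)"
  by (induction I rule: infinite_finite_induct) (simp_all add: regular_const regular_add)

lemma regular_prod: "(\<And>i. i \<in> I \<Longrightarrow> regular n (\<phi> i)) \<Longrightarrow> regular n (\<lambda>g. \<Prod>i\<in>I. \<phi> i g)"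
  by (induction I rule: infinite_finite_induct) (simp_all add: regular_const regular_mult)

lemma regular_det:
  assumes "\<And>i j. i < m \<Longrightarrow> j < m \<Longrightarrow> regular n (\<lambda>g. F g (i, j))"
  shows "regular n (\<lambda>g. det (mat m m (F g)))"
proof -
  have "det (mat m m (F g)) = (\<Sum>p\<in>{p. p permutes {0..<m}}. signof p * (\<Prod>i = 0..<m. F g (i, p i)))" for g
    unfolding det_def
    by (auto intro!: sum.cong prod.cong arg_cong2[where f = "(*)"] simp: permutes_in_image)
  moreover have "regular n (\<lambda>g. \<Sum>p\<in>{p. p permutes {0..<m}}. signof p * (\<Prod>i = 0..<m. F g (i, p i)))"
    by (intro regular_sum regular_mult regular_const regular_prod assms) (auto simp: permutes_in_image)
  ultimately show ?thesis
    by simp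
qed

text \<open>Regular functions restrict to polynomials on lines, so the union of two proper zero loci is
  proper.\<close>

lemma regular_line:
  fixes g0 g1 :: "'a::field mat"
  assumes "regular n \<phi>"
  shows "\<exists>q. \<forall>s. poly q s = \<phi> (mat n n (\<lambda>e. g0 $$ e + s * (g1 $$ e - g0 $$ e)))"
proof -
  obtain f where f: "regular_pol n f" "\<And>g. subst_pol id (\<lambda>e. g $$ e) f = \<phi> g"
    using assms unfolding regular_def by blast
  define q where "q = (\<Sum>m\<in>keys f. [:lookup f m:] *
    (\<Prod>v\<in>keys m. [:g0 $$ v, g1 $$ v - g0 $$ v:] ^ lookup m v))"
  have "poly q s = \<phi> (mat n n (\<lambda>e. g0 $$ e + s * (g1 $$ e - g0 $$ e)))" for s
  proof -
    have "mat n n (\<lambda>e. g0 $$ e + s * (g1 $$ e - g0 $$ e)) $$ v = poly [:g0 $$ v, g1 $$ v - g0 $$ v:] s"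
      if "m \<in> keys f" "v \<in> keys m" for m v
    proof -
      have "v \<in> {..<n} \<times> {..<n}"
        using f(1) that unfolding regular_pol_def by blast
      then show ?thesis by (cases v) auto
    qed
    then have "subst_pol id (\<lambda>e. mat n n (\<lambda>e. g0 $$ e + s * (g1 $$ e - g0 $$ e)) $$ e) f = poly q s"
      unfolding subst_pol_def q_def by (simp add: poly_sum poly_prod)
    then show ?thesis
      using f(2) by simp
  qed
  then show ?thesis by blast
qed

text \<open>On the line from \<open>g0\<close> at s = 0 to \<open>g1\<close> at s = 1 both functions
  are nonzero polynomials in s. Their product has finitely many roots, and a field of characteristic
  zero is infinite.\<close>

lemma regular_nonzero_Int:
  fixes \<phi> \<psi> :: "'a::field_char_0 mat \<Rightarrow> 'a"
  assumes "regular n \<phi>" "regular n \<psi>" "\<phi> g0 \<noteq> 0" "\<psi> g1 \<noteq> 0"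
    and g: "g0 \<in> carrier_mat n n" "g1 \<in> carrier_mat n n"
  shows "\<exists>g\<in>carrier_mat n n. \<phi> g \<noteq> 0 \<and> \<psi> g \<noteq> 0"
proof -
  define L where "L s = mat n n (\<lambda>e. g0 $$ e + s * (g1 $$ e - g0 $$ e))" for s
  obtain p q where pq: "\<And>s. poly p s = \<phi> (L s)" "\<And>s. poly q s = \<psi> (L s)"
    using regular_line[OF assms(1), of g0 g1] regular_line[OF assms(2), of g0 g1]
    unfolding L_def by blast
  have "L 0 = g0" "L 1 = g1"
    using g by (auto simp: L_def)
  then have "p \<noteq> 0" "q \<noteq> 0"
    using assms(3,4) pq by (metis poly_0)+
  then have "finite {s. poly (p * q) s = 0}"
    by (intro poly_roots_finite) simp
  then obtain s where "poly (p * q) s \<noteq> 0"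
    using ex_new_if_finite[OF infinite_UNIV_char_0] by blast
  then show ?thesis
    using pq by (intro bexI[of _ "L s"]) (auto simp: L_def)
qed

lemma regular_nonzero_INT:
  fixes \<phi> :: "'i \<Rightarrow> 'a::field_char_0 mat \<Rightarrow> 'a"
  assumes "finite I" "\<And>i. i \<in> I \<Longrightarrow> regular n (\<phi> i)"
    and "\<And>i. i \<in> I \<Longrightarrow> \<exists>g\<in>carrier_mat n n. \<phi> i g \<noteq> 0"
  shows "\<exists>g\<in>carrier_mat n n. (\<Prod>i\<in>I. \<phi> i g) \<noteq> 0"
  using assms
proof (induction I rule: finite_induct)
  case empty
  then show ?case by (auto intro: bexI[of _ "0\<^sub>m n n"])
next
  case (insert i I)
  have reg: "regular n (\<lambda>g. \<Prod>i\<in>I. \<phi> i g)" "regular n (\<phi> i)"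
    using insert.prems(1) by (auto intro: regular_prod)
  obtain g0 g1 where "g0 \<in> carrier_mat n n" "\<phi> i g0 \<noteq> 0"
      "g1 \<in> carrier_mat n n" "(\<Prod>i\<in>I. \<phi> i g1) \<noteq> 0"
    using insert.IH insert.prems by blast
  then obtain g where "g \<in> carrier_mat n n" "\<phi> i g \<noteq> 0" "(\<Prod>i\<in>I. \<phi> i g) \<noteq> 0"
    using regular_nonzero_Int[OF reg(2,1)] by blast
  then show ?case
    using insert.hyps by (intro bexI[of _ g]) auto
qed

subsection \<open>General position\<close>

text \<open>Invertible iff the linear forms \<open>g x_j\<close> with \<open>j\<close> in \<open>D\<close> are independent modulo the last
  \<open>n - |D|\<close> variables.\<close>

definition completion :: "nat \<Rightarrow> nat set \<Rightarrow> 'a::field mat \<Rightarrow> 'a mat" where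
  "completion n D g = mat n n (\<lambda>(i, c). if c < card D then g $$ (i, sorted_list_of_set D ! c)
     else if i = c then 1 else 0)"

text \<open>Taking the product over all \<open>D\<close> turns finitely many open conditions into
  the nonvanishing of one regular function.\<close>

definition general_position :: "nat \<Rightarrow> 'a::field mat \<Rightarrow> 'a" where
  "general_position n g = (\<Prod>D\<in>Pow {..<n}. det (completion n D g))"

lemma nth_sorted_list_of_set_mem:
  "finite D \<Longrightarrow> c < card D \<Longrightarrow> sorted_list_of_set D ! c \<in> D"
  by (metis nth_mem length_sorted_list_of_set set_sorted_list_of_set)

lemma regular_det_completion:
  assumes "D \<subseteq> {..<n}"
  shows "regular n (\<lambda>g. det (completion n D g))"
  unfolding completion_def
proof (rule regular_det)
  fix i j assume ij: "i < n" "j < n"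
  have fin: "finite D" using assms finite_subset by blast
  show "regular n (\<lambda>g. case (i, j) of (i, c) \<Rightarrow>
      if c < card D then g $$ (i, sorted_list_of_set D ! c) else if i = c then 1 else 0)"
  proof (cases "j < card D")
    case True
    then have "sorted_list_of_set D ! j < n"
      using nth_sorted_list_of_set_mem[OF fin] assms by blast
    then show ?thesis
      using True ij by (simp add: regular_entry)
  qed (simp add: regular_const)
qed

lemma regular_general_position: "regular n (general_position n)"
  unfolding general_position_def[abs_def]
  by (intro regular_prod regular_det_completion) auto

text \<open>The conditions can be met one \<open>D\<close> at a time: sending the c-th variable of
  \<open>D\<close> to variable c makes the completion the identity matrix.\<close>

lemma ex_general_position:
  "\<exists>g\<in>carrier_mat n n. general_position n (g :: 'a::field_char_0 mat) \<noteq> 0"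
  unfolding general_position_def
proof (rule regular_nonzero_INT)
  fix D assume D: "D \<in> Pow {..<n}"
  then show "regular n (\<lambda>g. det (completion n D g))"
    by (intro regular_det_completion) auto
  have fin: "finite D" using D finite_subset by auto
  define g :: "'a mat" where
    "g = mat n n (\<lambda>(i, j). if i < card D \<and> sorted_list_of_set D ! i = j then 1 else 0)"
  have "completion n D g = 1\<^sub>m n"
  proof (rule eq_matI)
    fix i c assume ic: "i < dim_row (1\<^sub>m n)" "c < dim_col (1\<^sub>m n)"
    show "completion n D g $$ (i, c) = 1\<^sub>m n $$ (i, c)"
    proof (cases "c < card D")
      case True
      then have "sorted_list_of_set D ! c < n"
        using nth_sorted_list_of_set_mem[OF fin] D by auto
      moreover have "sorted_list_of_set D ! i = sorted_list_of_set D ! c \<longleftrightarrow> i = c" if "i < card D"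
        using that True by (simp add: nth_eq_iff_index_eq)
      ultimately show ?thesis
        using True ic by (auto simp: completion_def g_def)
    qed (use ic in \<open>simp add: completion_def\<close>)
  qed (simp_all add: completion_def)
  then show "\<exists>g\<in>carrier_mat n n. det (completion n D g) \<noteq> (0 :: 'a)"
    by (intro bexI[of _ g]) (simp_all add: g_def)
qed simp

text \<open>The columns of \<open>completion n D g\<close> are the coefficients of the forms with
  index in \<open>D\<close> and of the variables from \<open>card D\<close> on. The inverse matrix
  \<open>C\<close> expresses each variable through them.\<close>

lemma general_position_linear_forms:
  fixes g :: "'a::field mat"
  assumes g: "g \<in> carrier_mat n n" "general_position n g \<noteq> 0" and D: "D \<subseteq> {..<n}" and i: "i < n"
  shows "mon_pol (var i) \<in> vs.span (linear_form n g ` D \<union> (\<lambda>i. mon_pol (var i)) ` {card D..<n})"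
proof -
  have fin: "finite D" using D finite_subset by blast
  let ?M = "completion n D g"
  have M: "?M \<in> carrier_mat n n" by (simp add: completion_def)
  have "det ?M \<noteq> 0"
    using g(2) D by (auto simp: general_position_def)
  then obtain C where C: "C \<in> carrier_mat n n" "?M * C = 1\<^sub>m n"
    using GL_inverse[of ?M n] M by (auto simp: GL_iff_det)
  have "linear_form n ?M c \<in> vs.span (linear_form n g ` D \<union> (\<lambda>i. mon_pol (var i)) ` {card D..<n})"
    if c: "c < n" for c
  proof (cases "c < card D")
    case True
    then have "linear_form n ?M c = linear_form n g (sorted_list_of_set D ! c)"
      unfolding linear_form_def using c by (intro sum.cong) (auto simp: completion_def)
    then show ?thesis
      using nth_sorted_list_of_set_mem[OF fin True] by (auto intro: vs.span_base)
  next
    case False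
    have "linear_form n ?M c = linear_form n (1\<^sub>m n) c"
      unfolding linear_form_def using False c by (intro sum.cong) (auto simp: completion_def)
    also have "\<dots> = mon_pol (var c)"
      by (rule linear_form_one[OF c])
    also have "\<dots> \<in> vs.span (linear_form n g ` D \<union> (\<lambda>i. mon_pol (var i)) ` {card D..<n})"
      using False c by (intro vs.span_base) auto
    finally show ?thesis .
  qed
  then have "(\<Sum>c<n. const (C $$ (c, i)) * linear_form n ?M c)
      \<in> vs.span (linear_form n g ` D \<union> (\<lambda>i. mon_pol (var i)) ` {card D..<n})"
    by (intro vs.span_sum vs.span_scale) auto
  moreover have "(\<Sum>c<n. const (C $$ (c, i)) * linear_form n ?M c) = mon_pol (var i)"
    using gl_act_linear_form[OF C(1) M i] C(2) linear_form_one[OF i] by simp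
  ultimately show ?thesis by simp
qed

subsection \<open>Spread products of linear forms in general position\<close>

text \<open>The images under \<open>shift_up t\<close> of the sorted lists of length k with entries
  below a.\<close>

definition spread_below :: "(nat \<Rightarrow> nat) \<Rightarrow> nat \<Rightarrow> nat \<Rightarrow> nat list set" where
  "spread_below t k a = {xs. length xs = k \<and> spread t xs \<and> (\<forall>p<k. xs ! p < a + offset t p)}"

lemma spread_below_mono: "a \<le> b \<Longrightarrow> spread_below t k a \<subseteq> spread_below t k b"
  by (auto simp: spread_below_def intro: less_le_trans)

text \<open>The largest admissible index at position k can follow every list: the preceding entry is
  at most \<open>b + offset t (k - 1)\<close>.\<close>

lemma spread_below_snoc:
  assumes "xs \<in> spread_below t k (Suc b)"
  shows "xs @ [b + offset t k] \<in> spread_below t (Suc k) (Suc b)"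
proof -
  have xs: "length xs = k" "spread t xs" "\<And>p. p < k \<Longrightarrow> xs ! p < Suc b + offset t p"
    using assms by (auto simp: spread_below_def)
  have "spread t (xs @ [b + offset t k])"
    unfolding spread_def
  proof (intro allI impI)
    fix r assume r: "Suc r < length (xs @ [b + offset t k])"
    show "(xs @ [b + offset t k]) ! r + t (Suc r) \<le> (xs @ [b + offset t k]) ! Suc r"
    proof (cases "Suc r < k")
      case True
      then show ?thesis
        using xs(1,2) by (simp add: nth_append spread_def)
    next
      case False
      then have "k = Suc r" using r xs(1) by simp
      then show ?thesis
        using xs(1) xs(3)[of r] by (simp add: nth_append)
    qed
  qed
  then show ?thesis
    using xs by (auto simp: spread_below_def nth_append less_Suc_eq)
qed

definition gens :: "nat \<Rightarrow> 'a::field mat \<Rightarrow> nat set \<Rightarrow> nat \<Rightarrow> 'a pol set" where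
  "gens n g D a = linear_form n g ` D \<union> (\<lambda>i. mon_pol (var i)) ` {a..<n}"

text \<open>The part of degree \<open>k\<close> of the ideal generated by \<open>gens n g D a\<close>; it is zero for \<open>k = 0\<close>.\<close>

definition gens_ideal :: "nat \<Rightarrow> 'a::field mat \<Rightarrow> nat set \<Rightarrow> nat \<Rightarrow> nat \<Rightarrow> 'a pol set" where
  "gens_ideal n g D a k =
     vs.span {l * h |l h. l \<in> gens n g D a \<and> (\<exists>j. Suc j = k \<and> h \<in> polys (mons_eq n j))}"

definition spread_products :: "nat \<Rightarrow> 'a::field mat \<Rightarrow> (nat \<Rightarrow> nat) \<Rightarrow> nat \<Rightarrow> nat \<Rightarrow> 'a pol set" where
  "spread_products n g t k a =
     vs.span ((\<lambda>xs. prod_list (map (linear_form n g) xs)) ` spread_below t k a)"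

lemma mult_span:
  fixes x :: "'a::field pol"
  assumes "x \<in> vs.span A" "\<And>y. y \<in> A \<Longrightarrow> l * y \<in> vs.span B"
  shows "l * x \<in> vs.span B"
proof -
  have "vs.subspace {x. l * x \<in> vs.span B}"
    unfolding vs.subspace_def
  proof (intro conjI ballI allI; simp)
    show "0 \<in> vs.span B" by (rule vs.span_zero)
    fix x y :: "'a pol" assume "l * x \<in> vs.span B" "l * y \<in> vs.span B"
    then show "l * (x + y) \<in> vs.span B"
      by (simp add: distrib_left vs.span_add)
  next
    fix a and x :: "'a pol" assume "l * x \<in> vs.span B"
    then have "const a * (l * x) \<in> vs.span B" by (rule vs.span_scale)
    then show "l * (const a * x) \<in> vs.span B" by (simp add: ac_simps)
  qed
  then have "vs.span A \<subseteq> {x. l * x \<in> vs.span B}"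
    using assms(2) by (intro vs.span_minimal) auto
  then show ?thesis using assms(1) by blast
qed

lemma spread_products_mono: "a \<le> b \<Longrightarrow> spread_products n g t k a \<subseteq> spread_products n g t k b"
  unfolding spread_products_def by (intro vs.span_mono image_mono spread_below_mono)

lemma spread_products_snoc:
  assumes "q \<in> spread_products n g t k (Suc b)"
  shows "linear_form n g (b + offset t k) * q \<in> spread_products n g t (Suc k) (Suc b)"
  using assms unfolding spread_products_def
proof (rule mult_span)
  fix y assume "y \<in> (\<lambda>xs. prod_list (map (linear_form n g) xs)) ` spread_below t k (Suc b)"
  then obtain xs where xs: "xs \<in> spread_below t k (Suc b)" "y = prod_list (map (linear_form n g) xs)"
    by blast
  have "linear_form n g (b + offset t k) * y
      = prod_list (map (linear_form n g) (xs @ [b + offset t k]))"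
    by (simp add: xs(2) mult.commute)
  then show "linear_form n g (b + offset t k) * y \<in> vs.span ((\<lambda>xs. prod_list (map (linear_form n g) xs))
      ` spread_below t (Suc k) (Suc b))"
    using spread_below_snoc[OF xs(1)] by (intro vs.span_base image_eqI)
qed

lemma gens_ideal_mult_linear_form:
  assumes "z \<in> gens_ideal n g D a k"
  shows "linear_form n g j * z \<in> gens_ideal n g D a (Suc k)"
  using assms unfolding gens_ideal_def
proof (rule mult_span)
  fix y assume "y \<in> {l * h |l h. l \<in> gens n g D a \<and> (\<exists>j. Suc j = k \<and> h \<in> polys (mons_eq n j))}"
  then obtain l h i where y: "y = l * h" "l \<in> gens n g D a" "Suc i = k" "h \<in> polys (mons_eq n i)"
    by blast
  have "linear_form n g j * h \<in> polys (mons_eq n k)"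
    using polys_mons_eq_mult[OF linear_form_in_polys y(4)] y(3) by (simp add: plus_1_eq_Suc)
  moreover have "linear_form n g j * y = l * (linear_form n g j * h)"
    by (simp add: y(1) ac_simps)
  ultimately show "linear_form n g j * y
      \<in> vs.span {l * h |l h. l \<in> gens n g D a \<and> (\<exists>j. Suc j = Suc k \<and> h \<in> polys (mons_eq n j))}"
    using y(2) by (intro vs.span_base) blast
qed

text \<open>The elements that split in this way form a subspace containing all spanning products.
  The cofactor h of the new form has degree one less, which is what the induction on the degree
  uses.\<close>

lemma gens_ideal_insert:
  assumes "z \<in> gens_ideal n g (insert N D) a (Suc k)"
  shows "\<exists>h\<in>polys (mons_eq n k). \<exists>z'\<in>gens_ideal n g D a (Suc k). z = linear_form n g N * h + z'"
proof -
  let ?L = "linear_form n g N" and ?H = "polys (mons_eq n k)" and ?Z = "gens_ideal n g D a (Suc k)"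
  have Z: "vs.subspace ?Z"
    unfolding gens_ideal_def by (rule vs.subspace_span)
  have sub: "vs.subspace {?L * h + z' |h z'. h \<in> ?H \<and> z' \<in> ?Z}"
    unfolding vs.subspace_def
  proof (intro conjI ballI allI)
    show "0 \<in> {?L * h + z' |h z'. h \<in> ?H \<and> z' \<in> ?Z}"
      using vs.subspace_0[OF Z] by (intro CollectI exI[of _ 0]) simp
    fix x y assume "x \<in> {?L * h + z' |h z'. h \<in> ?H \<and> z' \<in> ?Z}" "y \<in> {?L * h + z' |h z'. h \<in> ?H \<and> z' \<in> ?Z}"
    then obtain h h' z z' where "h \<in> ?H" "h' \<in> ?H" "z \<in> ?Z" "z' \<in> ?Z" "x = ?L * h + z" "y = ?L * h' + z'"
      by blast
    then have "x + y = ?L * (h + h') + (z + z')" "h + h' \<in> ?H" "z + z' \<in> ?Z"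
      by (simp_all add: algebra_simps polys_add vs.subspace_add[OF Z])
    then show "x + y \<in> {?L * h + z' |h z'. h \<in> ?H \<and> z' \<in> ?Z}"
      by blast
  next
    fix c x assume "x \<in> {?L * h + z' |h z'. h \<in> ?H \<and> z' \<in> ?Z}"
    then obtain h z where "h \<in> ?H" "z \<in> ?Z" "x = ?L * h + z"
      by blast
    then have "const c * x = ?L * (const c * h) + const c * z" "const c * h \<in> ?H" "const c * z \<in> ?Z"
      by (simp_all add: distrib_left mult.left_commute polys_const_times vs.subspace_scale[OF Z])
    then show "const c * x \<in> {?L * h + z' |h z'. h \<in> ?H \<and> z' \<in> ?Z}"
      by blast
  qed
  have "{l * h |l h. l \<in> gens n g (insert N D) a \<and> (\<exists>j. Suc j = Suc k \<and> h \<in> polys (mons_eq n j))}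
      \<subseteq> {?L * h + z' |h z'. h \<in> ?H \<and> z' \<in> ?Z}"
  proof
    fix y assume "y \<in> {l * h |l h. l \<in> gens n g (insert N D) a \<and> (\<exists>j. Suc j = Suc k \<and> h \<in> polys (mons_eq n j))}"
    then obtain l h where y: "y = l * h" "l \<in> gens n g (insert N D) a" "h \<in> ?H"
      by blast
    show "y \<in> {?L * h + z' |h z'. h \<in> ?H \<and> z' \<in> ?Z}"
    proof (cases "l = ?L")
      case True
      then show ?thesis
        using y vs.subspace_0[OF Z] by (intro CollectI exI[of _ h] exI[of _ 0]) simp
    next
      case False
      then have "l \<in> gens n g D a"
        using y(2) by (auto simp: gens_def)
      then have "y \<in> ?Z"
        unfolding gens_ideal_def using y by (intro vs.span_base) blast
      then show ?thesis
        by (intro CollectI exI[of _ 0] exI[of _ y]) simp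
    qed
  qed
  then have "gens_ideal n g (insert N D) a (Suc k) \<subseteq> {?L * h + z' |h z'. h \<in> ?H \<and> z' \<in> ?Z}"
    unfolding gens_ideal_def[of n g "insert N D"] by (rule vs.span_minimal[OF _ sub])
  then show ?thesis using assms by blast
qed

text \<open>Linear forms in general position vanish simultaneously with the last variables only at the
  origin.\<close>

lemma gens_ideal_all:
  assumes g: "g \<in> carrier_mat n n" "general_position n g \<noteq> 0" and D: "D \<subseteq> {..<n}"
    and p: "p \<in> polys (mons_eq n (Suc k))"
  shows "p \<in> gens_ideal n g D (card D) (Suc k)"
proof -
  have mon: "mon_pol u \<in> gens_ideal n g D (card D) (Suc k)" if u: "u \<in> mons_eq n (Suc k)" for u
  proof -
    obtain i where "i \<in> keys u"
      using u by (force simp: mons_eq_def mdeg_eq_0_iff)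
    define v where "v = u - var i"
    have uv: "u = var i + v"
      unfolding v_def by (rule var_add_minus[OF \<open>i \<in> keys u\<close>, symmetric])
    have "i < n" "v \<in> mons_eq n k"
      using u unfolding uv by (auto simp: mons_eq_def plus_1_eq_Suc)
    have "mon_pol v * mon_pol (var i) \<in> gens_ideal n g D (card D) (Suc k)"
      unfolding gens_ideal_def
    proof (rule mult_span)
      show "mon_pol (var i) \<in> vs.span (gens n g D (card D))"
        unfolding gens_def by (rule general_position_linear_forms[OF g D \<open>i < n\<close>])
      fix y assume "y \<in> gens n g D (card D)"
      then show "mon_pol v * y \<in> vs.span {l * h |l h. l \<in> gens n g D (card D) \<and>
          (\<exists>j. Suc j = Suc k \<and> h \<in> polys (mons_eq n j))}"
        using single_in_polys[OF \<open>v \<in> mons_eq n k\<close>] mult.commute[of "mon_pol v" y]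
        by (intro vs.span_base) blast
    qed
    then show ?thesis
      by (simp add: mult_single uv add.commute)
  qed
  have "(\<Sum>u\<in>keys p. const (lookup p u) * mon_pol u) \<in> gens_ideal n g D (card D) (Suc k)"
    unfolding gens_ideal_def
    by (intro vs.span_sum vs.span_scale) (use mon p in \<open>auto simp: gens_ideal_def polys_def\<close>)
  then show ?thesis
    by (simp add: sum_single_lookup flip: single_eq_const_times)
qed

text \<open>Let \<open>N\<close> be the largest admissible index. Working modulo \<open>L_N\<close> lowers \<open>a\<close> by one, and the
  multiples of \<open>L_N\<close> are handled by lowering \<open>k\<close> by one.\<close>

lemma spread_products_span:
  assumes g: "g \<in> carrier_mat n n" "general_position n g \<noteq> 0"
    and "D \<subseteq> {..<n}" "D \<inter> {..<a + offset t (k - 1)} = {}"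
    and "0 < k \<Longrightarrow> 0 < a \<Longrightarrow> a + offset t (k - 1) \<le> n"
    and "p \<in> polys (mons_eq n k)"
  shows "\<exists>q\<in>spread_products n g t k a. p - q \<in> gens_ideal n g D (a + card D) k"
  using assms(3-)
proof (induction k arbitrary: a D p)
  case 0
  have "keys p \<subseteq> {0}"
    using 0 by (auto simp: polys_def mons_eq_def mdeg_eq_0_iff)
  then have "p = const (lookup p 0)"
    by (auto intro!: poly_mapping_eqI simp: lookup_single when_def in_keys_iff)
  \<comment> \<open>The empty list is the only list of length 0, and its product is 1.\<close>
  moreover have "const c * 1 \<in> spread_products n g t 0 a" for c
    unfolding spread_products_def
    by (intro vs.span_scale vs.span_base image_eqI[of _ _ "[]"]) (auto simp: spread_below_def spread_def)
  ultimately have "p \<in> spread_products n g t 0 a"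
    by (metis mult_1_right)
  then show ?case
    by (intro bexI[of _ p]) (auto simp: gens_ideal_def vs.span_zero)
next
  case (Suc k)
  note IH = Suc.IH
  show ?case
    using Suc.prems
  proof (induction a arbitrary: D p)
    case 0
    \<comment> \<open>For a = 0 there are no spread lists of positive length, so q must be 0; the
      forms indexed by \<open>D\<close> and the variables from \<open>card D\<close> on already
      generate everything in positive degree.\<close>
    have "p - 0 \<in> gens_ideal n g D (0 + card D) (Suc k)"
      using gens_ideal_all[OF g 0(1,4)] by simp
    moreover have "0 \<in> spread_products n g t (Suc k) 0"
      unfolding spread_products_def by (rule vs.span_zero)
    ultimately show ?case by blast
  next
    case (Suc b)
    define N where "N = b + offset t k"
    have N: "N < n" "N \<notin> D"
      using Suc.prems(2,3) by (auto simp: N_def)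
    have fin: "finite D" using Suc.prems(1) finite_subset by blast
    \<comment> \<open>Lowering a by one while adding N to \<open>D\<close> leaves a + |D| unchanged,
      so the same variables are killed. All indices in \<open>insert N D\<close> are at least N, as
      the disjointness condition for b requires.\<close>
    have "\<exists>q\<in>spread_products n g t (Suc k) b. p - q \<in> gens_ideal n g (insert N D) (b + card (insert N D)) (Suc k)"
      using Suc.prems N by (intro Suc.IH) (auto simp: N_def)
    then obtain q1 where q1: "q1 \<in> spread_products n g t (Suc k) b"
        "p - q1 \<in> gens_ideal n g (insert N D) (Suc b + card D) (Suc k)"
      using fin N(2) by auto
    obtain h z where h: "h \<in> polys (mons_eq n k)" and z: "z \<in> gens_ideal n g D (Suc b + card D) (Suc k)"
        and p: "p - q1 = linear_form n g N * h + z"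
      using gens_ideal_insert[OF q1(2)] by blast
    \<comment> \<open>The cofactor h has degree k and is treated by the outer induction with the old
      \<open>D\<close> and bound \<open>Suc b\<close>. Multiplying the resulting products by the
      form of index N appends N to the lists.\<close>
    have "offset t (k - 1) \<le> offset t k"
      by (rule offset_mono) simp
    then have "\<exists>q\<in>spread_products n g t k (Suc b). h - q \<in> gens_ideal n g D (Suc b + card D) k"
      using Suc.prems h by (intro IH) (auto simp: disjoint_iff)
    then obtain q2 where q2: "q2 \<in> spread_products n g t k (Suc b)"
        "h - q2 \<in> gens_ideal n g D (Suc b + card D) k"
      by blast
    have q: "q1 + linear_form n g N * q2 \<in> spread_products n g t (Suc k) (Suc b)"
      using subsetD[OF spread_products_mono[OF le_SucI[OF order_refl]] q1(1)]
        spread_products_snoc[OF q2(1)]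
      unfolding spread_products_def N_def by (rule vs.span_add)
    have eq: "p - (q1 + linear_form n g N * q2) = linear_form n g N * (h - q2) + z"
      using p by (simp add: algebra_simps)
    have "linear_form n g N * (h - q2) + z \<in> gens_ideal n g D (Suc b + card D) (Suc k)"
      using gens_ideal_mult_linear_form[OF q2(2)] z unfolding gens_ideal_def by (intro vs.span_add)
    with q show ?case
      unfolding eq[symmetric] by (rule bexI[rotated])
  qed
qed

lemma gens_ideal_keys:
  "gens_ideal n g {} a k \<subseteq> polys {v\<in>mons_eq n k. \<exists>i\<in>keys v. a \<le> i}"
  unfolding gens_ideal_def
proof (rule vs.span_minimal[OF _ subspace_polys], rule subsetI)
  fix y assume "y \<in> {l * h |l h. l \<in> gens n g {} a \<and> (\<exists>j. Suc j = k \<and> h \<in> polys (mons_eq n j))}"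
  then obtain i h j where y: "y = mon_pol (var i) * h" "i \<in> {a..<n}" "Suc j = k" "h \<in> polys (mons_eq n j)"
    by (auto simp: gens_def)
  have "(mon_pol (var i) :: 'a pol) \<in> polys {var i}"
    by (simp add: polys_def)
  then show "y \<in> polys {v\<in>mons_eq n k. \<exists>i\<in>keys v. a \<le> i}"
    unfolding y(1) using y by (elim polys_mult) (auto simp: mons_eq_def keys_add_mon plus_1_eq_Suc)
qed

text \<open>With \<open>D\<close> empty, \<open>spread_products_span\<close> gives a combination q
  of spread products that agrees with w modulo the variables from a on. In reverse lexicographic
  order every other monomial of degree k involving such a variable is smaller than w, so w is the
  leading monomial of q.\<close>

lemma mem_leads_spread_below:
  fixes g :: "'a::field mat"
  assumes g: "g \<in> carrier_mat n n" "general_position n g \<noteq> 0"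
    and a: "0 < k \<Longrightarrow> 0 < a \<Longrightarrow> a + offset t (k - 1) \<le> n"
    and w: "w \<in> mons_eq n k" "keys w \<subseteq> {..<a}"
  shows "w \<in> leads n g (mon_of ` spread_below t k a)"
proof -
  have "(mon_pol w :: 'a pol) \<in> polys (mons_eq n k)"
    using w(1) by (rule single_in_polys)
  then obtain q where q: "q \<in> spread_products n g t k a" "mon_pol w - q \<in> gens_ideal n g {} (a + card ({} :: nat set)) k"
    using spread_products_span[OF g, of "{}" a t k "mon_pol w"] a by auto
  define z where "z = mon_pol w - q"
  have z: "z \<in> polys {v\<in>mons_eq n k. \<exists>i\<in>keys v. a \<le> i}"
    using q(2) gens_ideal_keys[of n g a k] by (auto simp: z_def)
  have qz: "q = mon_pol w - z" by (simp add: z_def)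
  have "spread_products n g t k a \<subseteq> gl_act n g ` polys (mon_of ` spread_below t k a)"
    unfolding spread_products_def
  proof (rule vs.span_minimal[OF _ subspace_gl_act_polys], rule subsetI)
    fix y assume "y \<in> (\<lambda>xs. prod_list (map (linear_form n g) xs)) ` spread_below t k a"
    then obtain xs where "xs \<in> spread_below t k a" "y = prod_list (map (linear_form n g) xs)"
      by blast
    then show "y \<in> gl_act n g ` polys (mon_of ` spread_below t k a)"
      using gl_act_mon_of[of n g xs] by (intro image_eqI[of _ _ "mon_pol (mon_of xs)"]) (auto intro!: single_in_polys)
  qed
  then have "q \<in> gl_act n g ` polys (mon_of ` spread_below t k a)"
    using q(1) by blast
  have "w \<notin> keys z"
    using z w(2) by (force simp: polys_def)
  then have "lookup q w = 1"
    by (simp add: qz lookup_minus in_keys_iff)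
  then have "w \<in> keys q"
    by (simp add: in_keys_iff)
  moreover have "revlex_less v w" if "v \<in> keys q" "v \<noteq> w" for v
  proof -
    have "v \<in> keys z"
      using that by (simp add: qz in_keys_iff lookup_minus lookup_single when_def split: if_splits)
    then obtain i where v: "v \<in> mons_eq n k" "i \<in> keys v" "a \<le> i"
      using z by (auto simp: polys_def)
    \<comment> \<open>The largest variable of v decides the comparison: its index is at least a,
      where w has exponent 0, and both exponents vanish beyond it.\<close>
    define m where "m = Max (keys v)"
    have m: "m \<in> keys v" "\<And>j. j \<in> keys v \<Longrightarrow> j \<le> m"
      using v(2) by (auto simp: m_def intro: Max_in)
    have "a \<le> m" using m(2)[OF v(2)] v(3) by simp
    have w0: "lookup w j = 0" if "a \<le> j" for j
    proof -
      have "j \<notin> keys w" using w(2) that by auto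
      then show ?thesis by (simp add: in_keys_iff)
    qed
    have v0: "lookup v j = 0" if "m < j" for j
      using m(2)[of j] that by (auto simp: in_keys_iff)
    have "lookup w m < lookup v m \<and> (\<forall>j>m. lookup v j = lookup w j)"
      using w0 v0 m(1) \<open>a \<le> m\<close> by (auto simp: in_keys_iff)
    then have "\<exists>m. lookup w m < lookup v m \<and> (\<forall>j>m. lookup v j = lookup w j)"
      by (rule exI)
    moreover have "mdeg v = mdeg w"
      using v(1) w(1) by (simp add: mons_eq_def)
    ultimately show ?thesis
      by (simp only: revlex_less_def simp_thms)
  qed
  ultimately have "lead_mon q = w"
    by (rule lead_mon_eqI)
  moreover have "q \<noteq> 0"
    using \<open>w \<in> keys q\<close> by auto
  ultimately show ?thesis
    using \<open>q \<in> gl_act n g ` polys (mon_of ` spread_below t k a)\<close> unfolding leads_def by blast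
qed

subsection \<open>The generic initial ideal\<close>

text \<open>The monomial y is the image of a form z of the same degree, obtained from the inverse
  matrix. Multiplying a preimage by z multiplies the image by y.\<close>

lemma leads_add:
  fixes g :: "'a::field mat"
  assumes g: "g \<in> GL n" and B: "B \<subseteq> mons n" and u: "u \<in> leads n g B" and y: "y \<in> mons n"
  shows "u + y \<in> leads n g {b + v |b v. b \<in> B \<and> v \<in> mons_eq n (mdeg y)}"
proof -
  obtain p where p: "p \<in> polys B" "gl_act n g p \<noteq> 0" "u = lead_mon (gl_act n g p)"
    using u by (auto simp: leads_def)
  obtain h where h: "h \<in> carrier_mat n n" "g * h = 1\<^sub>m n"
    using GL_inverse[OF g] by blast
  define z where "z = gl_act n h (mon_pol y)"
  have "z \<in> polys (mons_eq n (mdeg y))"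
    unfolding z_def by (rule gl_act_mon_pol_in_polys)
  with p(1) have pz: "p * z \<in> polys {b + v |b v. b \<in> B \<and> v \<in> mons_eq n (mdeg y)}"
    by (rule polys_mult) blast
  have "gl_act n g z = mon_pol y"
    unfolding z_def using g h y by (intro gl_act_inverse) (auto simp: GL_def single_in_polys)
  then have eq: "gl_act n g (p * z) = gl_act n g p * mon_pol y"
    by (simp add: gl_act_mult)
  have "gl_act n g (p * z) \<noteq> 0"
    unfolding eq by (rule lead_mon_times_mon_pol(1)[OF p(2)])
  moreover have "u + y = lead_mon (gl_act n g (p * z))"
    unfolding eq p(3) by (rule lead_mon_times_mon_pol(2)[OF p(2), symmetric])
  ultimately show ?thesis
    unfolding leads_def using pz by blast
qed

lemma leads_mdeg:
  assumes "\<And>b. b \<in> B \<Longrightarrow> mdeg b \<le> D" "u \<in> leads n g B"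
  shows "mdeg u \<le> D"
proof -
  obtain p where p: "p \<in> polys B" "gl_act n g p \<noteq> 0" "u = lead_mon (gl_act n g p)"
    using assms(2) by (auto simp: leads_def)
  have "gl_act n g p \<in> polys {u\<in>mons n. mdeg u \<le> D}"
    by (rule gl_act_in_polys[OF assms(1) p(1)])
  then show ?thesis
    using lead_mon(1)[OF p(2)] p(3) by (auto simp: polys_def)
qed

lemma leads_bounded:
  assumes "u \<in> leads n g B"
  shows "\<exists>D. u \<in> leads n g {b\<in>B. mdeg b \<le> D}"
proof -
  obtain p where p: "p \<in> polys B" "gl_act n g p \<noteq> 0" "u = lead_mon (gl_act n g p)"
    using assms by (auto simp: leads_def)
  define D where "D = Max (insert 0 (mdeg ` keys p))"
  have "mdeg b \<le> D" if "b \<in> keys p" for b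
    using that by (simp add: D_def)
  then have "p \<in> polys {b\<in>B. mdeg b \<le> D}"
    using p(1) by (auto simp: polys_def)
  then have "lead_mon (gl_act n g p) \<in> leads n g {b\<in>B. mdeg b \<le> D}"
    unfolding leads_def using p(2) by blast
  then show ?thesis
    unfolding p(3) by (rule exI)
qed

section \<open>Initial ideals from a comparison of cardinalities\<close>

context spread_stable
begin

lemma up_T_subset_mons: "up n (mon_of ` T) \<subseteq> mons n" "up n (mon_of ` shift_down t ` T) \<subseteq> mons n"
proof -
  have "mon_of ` T \<subseteq> mons n" "mon_of ` shift_down t ` T \<subseteq> mons n"
    using bound_T shift_down_set_less[OF bound_T] by (auto simp: mon_of_in_mons)
  then show "up n (mon_of ` T) \<subseteq> mons n" "up n (mon_of ` shift_down t ` T) \<subseteq> mons n"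
    by (simp_all add: up_subset_mons)
qed

text \<open>By \<open>leads_add\<close> the shifted monomials and their multiples occur as leading
  monomials; restricting to lists of equal length keeps the degrees at most D. By
  \<open>card_leads\<close> and \<open>card_up_le\<close> there is no room for further ones.\<close>

lemma leads_up_le:
  fixes g :: "'a::field mat"
  assumes g: "g \<in> GL n"
    and leads: "\<And>xs. xs \<in> T \<Longrightarrow>
      mon_of (shift_down t xs) \<in> leads n g (mon_of ` {ys\<in>T. length ys = length xs})"
  shows "leads n g {w\<in>up n (mon_of ` T). mdeg w \<le> D}
    = {w\<in>up n (mon_of ` shift_down t ` T). mdeg w \<le> D}"
proof -
  let ?B = "{w\<in>up n (mon_of ` T). mdeg w \<le> D}"
  let ?C = "{w\<in>up n (mon_of ` shift_down t ` T). mdeg w \<le> D}"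
  have "?B \<subseteq> {w\<in>mons n. mdeg w \<le> D}"
    using up_T_subset_mons by auto
  moreover have "finite {w\<in>mons n. mdeg w \<le> D}"
    using finite_mons_le[of "{..<n}" D] by (simp add: mons_le_def mons_def)
  ultimately have B: "?B \<subseteq> mons n" "finite ?B"
    using finite_subset by auto
  have "?C \<subseteq> leads n g ?B"
  proof
    fix w assume "w \<in> ?C"
    then obtain xs y where xs: "xs \<in> T" and y: "y \<in> mons n" and w: "w = mon_of (shift_down t xs) + y"
        and deg: "mdeg w \<le> D"
      unfolding up_def by blast
    let ?X = "mon_of ` {ys\<in>T. length ys = length xs}"
    have "?X \<subseteq> mons n"
      using bound_T by (auto simp: mon_of_in_mons)
    then have "w \<in> leads n g {b + v |b v. b \<in> ?X \<and> v \<in> mons_eq n (mdeg y)}"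
      unfolding w by (rule leads_add[OF g _ leads[OF xs] y])
    moreover have "{b + v |b v. b \<in> ?X \<and> v \<in> mons_eq n (mdeg y)} \<subseteq> ?B"
    proof
      fix z assume "z \<in> {b + v |b v. b \<in> ?X \<and> v \<in> mons_eq n (mdeg y)}"
      then obtain ys v where "ys \<in> T" "length ys = length xs" "z = mon_of ys + v" "v \<in> mons n" "mdeg v = mdeg y"
        unfolding mons_eq_def by blast
      then show "z \<in> ?B"
        using deg unfolding up_def w by auto
    qed
    ultimately show "w \<in> leads n g ?B"
      by (rule subsetD[OF leads_mono, rotated])
  qed
  moreover have "card (leads n g ?B) \<le> card ?C"
    using card_leads(1)[OF g B] card_up_le[of D] by simp
  ultimately have "?C = leads n g ?B"
    by (rule card_seteq[OF card_leads(2)[OF g B]])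
  then show ?thesis
    by simp
qed

text \<open>A polynomial has bounded degree, so the equality up to each degree D gives the equality
  of all leading monomials.\<close>

lemma initial_ideal_up:
  fixes g :: "'a::field mat"
  assumes g: "g \<in> GL n"
    and leads: "\<And>xs. xs \<in> T \<Longrightarrow>
      mon_of (shift_down t xs) \<in> leads n g (mon_of ` {ys\<in>T. length ys = length xs})"
  shows "initial_ideal n (gl_act n g ` polys (up n (mon_of ` T)))
    = polys (up n (mon_of ` shift_down t ` T))"
proof -
  let ?N = "up n (mon_of ` shift_down t ` T)"
  have "leads n g (up n (mon_of ` T)) = ?N"
  proof
    show "leads n g (up n (mon_of ` T)) \<subseteq> ?N"
    proof
      fix u assume "u \<in> leads n g (up n (mon_of ` T))"
      then obtain D where "u \<in> leads n g {w\<in>up n (mon_of ` T). mdeg w \<le> D}"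
        using leads_bounded by blast
      also have "leads n g {w\<in>up n (mon_of ` T). mdeg w \<le> D} = {w\<in>?N. mdeg w \<le> D}"
        by (rule leads_up_le[OF g leads])
      finally show "u \<in> ?N"
        by simp
    qed
    show "?N \<subseteq> leads n g (up n (mon_of ` T))"
    proof
      fix w assume "w \<in> ?N"
      moreover have "leads n g {w'\<in>up n (mon_of ` T). mdeg w' \<le> mdeg w}
          = {w'\<in>?N. mdeg w' \<le> mdeg w}"
        by (rule leads_up_le[OF g leads])
      ultimately have "w \<in> leads n g {w'\<in>up n (mon_of ` T). mdeg w' \<le> mdeg w}"
        by simp
      then show "w \<in> leads n g (up n (mon_of ` T))"
        by (rule subsetD[OF leads_mono, rotated]) auto
    qed
  qed
  then show ?thesis
    using mon_ideal_eq[of ?N n] up_T_subset_mons(2) by (simp add: initial_ideal_def leads_def)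
qed

end

section \<open>Leading monomials for lists below a bound, then for lists below a given list\<close>

lemma spread_stable_spread_below:
  assumes "a + offset t (k - 1) \<le> n"
  shows "spread_stable t n (spread_below t k a)"
proof
  have bound: "set xs \<subseteq> {..<n}" if xs: "xs \<in> spread_below t k a" for xs
  proof
    fix x assume "x \<in> set xs"
    then obtain p where p: "p < k" "x = xs ! p"
      using xs by (auto simp: spread_below_def in_set_conv_nth)
    moreover have "offset t p \<le> offset t (k - 1)"
      using p(1) by (intro offset_mono) simp
    moreover have "xs ! p < a + offset t p"
      using xs p(1) by (simp add: spread_below_def)
    ultimately show "x \<in> {..<n}"
      using assms by simp
  qed
  then show "set xs \<subseteq> {..<n}" if "xs \<in> spread_below t k a" for xs
    using that by blast
  have "spread_below t k a \<subseteq> {xs. set xs \<subseteq> {..<n} \<and> length xs = k}"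
    using bound by (auto simp: spread_below_def)
  then show "finite (spread_below t k a)"
    using finite_lists_length_eq[of "{..<n}" k] finite_subset by blast
  show "spread t xs" if "xs \<in> spread_below t k a" for xs
    using that by (simp add: spread_below_def)
  fix xs ys assume xs: "xs \<in> spread_below t k a" and ys: "spread t ys" "list_all2 (\<le>) ys xs"
  have "length ys = k"
    using xs list_all2_lengthD[OF ys(2)] by (simp add: spread_below_def)
  moreover have "ys ! p < a + offset t p" if "p < k" for p
  proof -
    have "ys ! p \<le> xs ! p"
      using list_all2_nthD[OF ys(2)] that \<open>length ys = k\<close> by simp
    also have "xs ! p < a + offset t p"
      using xs that by (simp add: spread_below_def)
    finally show ?thesis .
  qed
  ultimately show "ys \<in> spread_below t k a"
    using ys(1) by (simp add: spread_below_def)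
qed

text \<open>All lists in \<open>spread_below t k a\<close> have length k, so
  \<open>mem_leads_spread_below\<close> supplies the hypothesis of \<open>leads_up_le\<close>. The
  leading monomials are then multiples of degree-k monomials in the first a variables.\<close>

lemma leads_spread_below:
  fixes g :: "'a::field mat"
  assumes g: "g \<in> GL n" "general_position n g \<noteq> 0" and a: "a + offset t (k - 1) \<le> n"
    and w: "w \<in> leads n g {w\<in>up n (mon_of ` spread_below t k a). mdeg w \<le> D}"
  shows "\<exists>xs y. length xs = k \<and> set xs \<subseteq> {..<a} \<and> sorted xs \<and> w = mon_of xs + y"
proof -
  interpret spread_stable t n "spread_below t k a"
    by (rule spread_stable_spread_below[OF a])
  have down: "length (shift_down t xs) = k" "set (shift_down t xs) \<subseteq> {..<a}"
      "sorted (shift_down t xs)" if xs: "xs \<in> spread_below t k a" for xs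
  proof -
    have "spread t xs" "length xs = k"
      using xs by (auto simp: spread_below_def)
    then show "sorted (shift_down t xs)" "length (shift_down t xs) = k"
      by (simp_all add: sorted_shift_down)
    show "set (shift_down t xs) \<subseteq> {..<a}"
    proof
      fix x assume "x \<in> set (shift_down t xs)"
      then obtain p where p: "p < k" "x = shift_down t xs ! p"
        unfolding in_set_conv_nth \<open>length (shift_down t xs) = k\<close> by blast
      have "xs ! p < a + offset t p"
        using xs p(1) by (simp add: spread_below_def)
      then show "x \<in> {..<a}"
        using p \<open>length xs = k\<close> spread_offset_le[OF \<open>spread t xs\<close>, of p] by simp
    qed
  qed
  have "mon_of (shift_down t xs) \<in> leads n g (mon_of ` {ys\<in>spread_below t k a. length ys = length xs})"
    if xs: "xs \<in> spread_below t k a" for xs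
  proof -
    have "{ys\<in>spread_below t k a. length ys = length xs} = spread_below t k a"
      using xs by (auto simp: spread_below_def)
    moreover have "mon_of (shift_down t xs) \<in> leads n g (mon_of ` spread_below t k a)"
    proof (rule mem_leads_spread_below[OF _ g(2) a])
      show "g \<in> carrier_mat n n" using g(1) by (simp add: GL_def)
      show "mon_of (shift_down t xs) \<in> mons_eq n k"
        using down[OF xs] shift_down_set_less[OF bound_T[OF xs]] by (simp add: mons_eq_def mon_of_in_mons)
      show "keys (mon_of (shift_down t xs)) \<subseteq> {..<a}"
        using down[OF xs] by simp
    qed
    ultimately show ?thesis by simp
  qed
  then have "w \<in> up n (mon_of ` shift_down t ` spread_below t k a)"
    using leads_up_le[OF g(1)] w by blast
  then show ?thesis
    using down unfolding up_def by blast
qed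

text \<open>The leading monomials all come from \<open>Z\<close>, the sorted lists componentwise at
  most \<open>shift_down t xs\<close>. Since \<open>Z\<close> is no larger than the number of
  leading monomials, each of its members occurs, in particular
  \<open>shift_down t xs\<close>.\<close>

lemma mem_leads_spread:
  fixes g :: "'a::field mat"
  assumes g: "g \<in> GL n" "general_position n g \<noteq> 0" and xs: "spread t xs" "set xs \<subseteq> {..<n}"
  shows "mon_of (shift_down t xs) \<in> leads n g (mon_of ` {ys. spread t ys \<and> list_all2 (\<le>) ys xs})"
proof -
  define Y where "Y = {ys. spread t ys \<and> list_all2 (\<le>) ys xs}"
  define Z where "Z = {zs. sorted zs \<and> list_all2 (\<le>) zs (shift_down t xs)}"
  have xsn: "xs ! p < n" if "p < length xs" for p
    using xs(2) nth_mem[OF that] by auto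
  have YX: "length ys = length xs" "spread t ys" "p < length xs \<Longrightarrow> ys ! p \<le> xs ! p" if "ys \<in> Y" for ys p
    using that by (auto simp: Y_def list_all2_conv_all_nth)
  have "set ys \<subseteq> {..<n}" if ys: "ys \<in> Y" for ys
  proof
    fix x assume "x \<in> set ys"
    then obtain p where p: "p < length xs" "x = ys ! p"
      unfolding in_set_conv_nth YX(1)[OF ys] by blast
    show "x \<in> {..<n}"
      using YX(3)[OF ys p(1)] xsn[OF p(1)] p(2) by simp
  qed
  then have Yn: "Y \<subseteq> {ys. set ys \<subseteq> {..<n} \<and> length ys = length xs}"
    using YX(1) by blast
  then have finY: "finite Y"
    using finite_lists_length_eq[of "{..<n}"] finite_subset by blast
  have Ym: "mon_of ` Y \<subseteq> mons n" "finite (mon_of ` Y)"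
    using Yn finY by (auto simp: mon_of_in_mons)
  have "leads n g (mon_of ` Y) \<subseteq> mon_of ` Z"
  proof
    fix v assume v: "v \<in> leads n g (mon_of ` Y)"
    have deg: "mdeg v \<le> length xs"
      by (rule leads_mdeg[OF _ v]) (use YX(1) in auto)
    have below: "p < mdeg v \<and> indices v ! p \<le> shift_down t xs ! p" if p: "p < length xs" for p
    proof -
      \<comment> \<open>The least bound with \<open>xs ! p < a + offset t p\<close>. With it the
        prefixes of length p + 1 of all lists in \<open>Y\<close> are in
        \<open>spread_below\<close>, so v has a divisor of degree p + 1 in the first a variables,
        which bounds its entry at position p.\<close>
      define a where "a = Suc (xs ! p - offset t p)"
      have off: "offset t p \<le> xs ! p"
        by (rule spread_offset_le[OF xs(1) p])
      have "mon_of ` Y \<subseteq> {w\<in>up n (mon_of ` spread_below t (Suc p) a). mdeg w \<le> length xs}"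
      proof
        fix w assume "w \<in> mon_of ` Y"
        then obtain ys where ys: "ys \<in> Y" "w = mon_of ys" by blast
        have "ys ! q < a + offset t q" if "q < Suc p" for q
          using spread_offset_mono[OF YX(2)[OF ys(1)], of q p] YX(1)[OF ys(1)] YX(3)[OF ys(1) p] that p off
          by (simp add: a_def)
        then have "take (Suc p) ys \<in> spread_below t (Suc p) a"
          using YX(1)[OF ys(1)] spread_take[OF YX(2)[OF ys(1)]] p by (simp add: spread_below_def)
        moreover have "mon_of (drop (Suc p) ys) \<in> mons n"
          using Yn ys(1) set_drop_subset[of "Suc p" ys] by (auto simp: mon_of_in_mons)
        moreover have "w = mon_of (take (Suc p) ys) + mon_of (drop (Suc p) ys)"
          unfolding ys(2) by (metis append_take_drop_id mon_of_append)
        ultimately have "w \<in> up n (mon_of ` spread_below t (Suc p) a)"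
          unfolding up_def by blast
        then show "w \<in> {w\<in>up n (mon_of ` spread_below t (Suc p) a). mdeg w \<le> length xs}"
          using YX(1)[OF ys(1)] ys(2) by simp
      qed
      then have "v \<in> leads n g {w\<in>up n (mon_of ` spread_below t (Suc p) a). mdeg w \<le> length xs}"
        using v by (rule subsetD[OF leads_mono])
      moreover have "a + offset t (Suc p - 1) \<le> n"
        using xsn[OF p] off by (simp add: a_def)
      ultimately obtain zs y where zs: "length zs = Suc p" "set zs \<subseteq> {..<a}" "sorted zs" "v = mon_of zs + y"
        using leads_spread_below[OF g] by blast
      have "mon_of zs + y = mon_of (indices v)"
        using zs(4) by simp
      note * = mon_of_dvd_nth_le[OF this zs(3) sorted_indices]
      have "zs ! p < a"
        using subsetD[OF zs(2) nth_mem[of p zs]] zs(1) by simp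
      then show ?thesis
        using *(1) *(2)[of p] zs(1) p by (simp add: a_def)
    qed
    have "length xs \<le> mdeg v"
    proof (rule ccontr)
      assume "\<not> length xs \<le> mdeg v"
      then show False using below[of "mdeg v"] by simp
    qed
    then have "indices v \<in> Z"
      using deg below by (simp add: Z_def list_all2_conv_all_nth sorted_indices)
    then show "v \<in> mon_of ` Z"
      by (metis image_eqI mon_of_indices)
  qed
  \<comment> \<open>The injection \<open>shift_up t\<close> bounds \<open>card Z\<close> by
    \<open>card Y\<close>, the number of leading monomials; so the inclusion just proved is an
    equality.\<close>
  moreover have "shift_up t ` Z \<subseteq> Y"
    using shift_up_mono[of _ "shift_down t xs" t] shift_up_down[OF xs(1)]
    by (auto simp: Y_def Z_def spread_shift_up)
  then have Z: "card Z \<le> card Y" "finite Z"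
    using finY inj_on_inverseI[of Z "shift_down t" "shift_up t"]
    by (auto intro: card_inj_on_le inj_on_finite)
  moreover have "inj_on mon_of Y"
    by (intro inj_on_inverseI[of _ indices] indices_mon_of spread_sorted[OF YX(2)])
  then have "card (leads n g (mon_of ` Y)) = card Y"
    using card_leads(1)[OF g(1) Ym] by (simp add: card_image)
  ultimately have "leads n g (mon_of ` Y) = mon_of ` Z"
    using card_image_le[OF Z(2), of mon_of] by (intro card_seteq) auto
  moreover have "shift_down t xs \<in> Z"
    using sorted_shift_down[OF xs(1)] by (simp add: Z_def list_all2_conv_all_nth)
  ultimately show ?thesis
    by (simp add: Y_def)
qed

section \<open>Generic matrices and the generic initial ideal\<close>

lemma regular_GL_nonzero:
  fixes \<phi> \<psi> :: "'a::field_char_0 mat \<Rightarrow> 'a"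
  assumes "regular n \<phi>" "regular n \<psi>" "\<exists>g\<in>carrier_mat n n. \<phi> g \<noteq> 0" "\<exists>g\<in>carrier_mat n n. \<psi> g \<noteq> 0"
  shows "\<exists>g\<in>GL n. \<phi> g \<noteq> 0 \<and> \<psi> g \<noteq> 0"
proof -
  have mat: "mat n n (\<lambda>e. g $$ e) = g" if "g \<in> carrier_mat n n" for g :: "'a mat"
    using that by auto
  \<comment> \<open>The determinant depends on the dimension of its argument. Rebuilding the matrix
    with \<open>mat n n\<close> makes it a regular function, so invertibility becomes one more
    nonvanishing condition.\<close>
  have det: "regular n (\<lambda>g :: 'a mat. det (mat n n (\<lambda>e. g $$ e)))"
    by (rule regular_det) (simp add: regular_entry)
  obtain a b where a: "a \<in> carrier_mat n n" "\<phi> a \<noteq> 0" and b: "b \<in> carrier_mat n n" "\<psi> b \<noteq> 0"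
    using assms(3,4) by blast
  obtain g0 where g0: "g0 \<in> carrier_mat n n" "\<phi> g0 \<noteq> 0" "\<psi> g0 \<noteq> 0"
    using regular_nonzero_Int[OF assms(1,2) a(2) b(2) a(1) b(1)] by blast
  have "det (mat n n (\<lambda>e. 1\<^sub>m n $$ e)) \<noteq> (0 :: 'a)"
    by (subst mat) simp_all
  then have "\<exists>g\<in>carrier_mat n n. \<phi> g * \<psi> g \<noteq> 0 \<and> det (mat n n (\<lambda>e. g $$ e)) \<noteq> 0"
    using g0 by (intro regular_nonzero_Int[OF regular_mult[OF assms(1,2)] det, of g0 "1\<^sub>m n"]) simp_all
  then obtain g where "g \<in> carrier_mat n n" "\<phi> g \<noteq> 0" "\<psi> g \<noteq> 0" "det (mat n n (\<lambda>e. g $$ e)) \<noteq> 0"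
    by auto
  then show ?thesis
    by (intro bexI[of _ g]) (simp_all add: GL_iff_det mat)
qed

context spread_stable
begin

text \<open>On the open set where \<open>general_position\<close> does not vanish, the initial ideal
  is the shifted ideal.\<close>

lemma Gin_up:
  "Gin n (polys (up n (mon_of ` T)) :: 'a::field_char_0 pol set)
    = polys (up n (mon_of ` shift_down t ` T))"
proof -
  let ?I = "polys (up n (mon_of ` T)) :: 'a pol set"
  let ?J = "polys (up n (mon_of ` shift_down t ` T)) :: 'a pol set"
  have J: "initial_ideal n (gl_act n g ` ?I) = ?J" if g: "g \<in> GL n" "general_position n g \<noteq> 0" for g
  proof (rule initial_ideal_up[OF g(1)])
    fix xs assume xs: "xs \<in> T"
    \<comment> \<open>Lists below \<open>xs\<close> stay in \<open>T\<close> and have its length, so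
      monotonicity of \<open>leads\<close> carries \<open>mem_leads_spread\<close> over to
      \<open>T\<close>.\<close>
    have "{ys. spread t ys \<and> list_all2 (\<le>) ys xs} \<subseteq> {ys\<in>T. length ys = length xs}"
      using down_T[OF xs] by (auto dest: list_all2_lengthD)
    then show "mon_of (shift_down t xs) \<in> leads n g (mon_of ` {ys\<in>T. length ys = length xs})"
      by (intro subsetD[OF leads_mono mem_leads_spread[OF g spread_T[OF xs] bound_T[OF xs]]] image_mono)
  qed
  obtain f :: "(nat \<times> nat \<Rightarrow>\<^sub>0 nat) \<Rightarrow>\<^sub>0 'a" where
    f: "regular_pol n f" "\<And>g. subst_pol id (\<lambda>e. g $$ e) f = general_position n g"
    using regular_general_position[of n] unfolding regular_def by blast
  show ?thesis
    unfolding Gin_def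
  proof (rule the_equality)
    show "\<exists>U. zariski_open_GL n U \<and> U \<noteq> {} \<and> (\<forall>g\<in>U. initial_ideal n (gl_act n g ` ?I) = ?J)"
    proof (intro exI conjI)
      show "zariski_open_GL n {g\<in>GL n. general_position n g \<noteq> (0::'a)}"
        unfolding zariski_open_GL_def
        by (rule exI[of _ "{f}"]) (use f in \<open>auto simp: regular_pol_def\<close>)
      show "{g\<in>GL n. general_position n g \<noteq> (0::'a)} \<noteq> {}"
        using regular_GL_nonzero[OF regular_general_position regular_general_position
            ex_general_position ex_general_position] by blast
      show "\<forall>g\<in>{g\<in>GL n. general_position n g \<noteq> 0}. initial_ideal n (gl_act n g ` ?I) = ?J"
        using J by blast
    qed
    \<comment> \<open>Uniqueness: a nonempty open U contains the invertible matrices at which one of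
      its polynomials f' does not vanish. One of these is in general position, and it forces the two
      ideals to agree.\<close>
    fix J' assume "\<exists>U. zariski_open_GL n U \<and> U \<noteq> {} \<and> (\<forall>g\<in>U. initial_ideal n (gl_act n g ` ?I) = J')"
    then obtain U where U: "zariski_open_GL n U" "U \<noteq> {}" "\<And>g. g \<in> U \<Longrightarrow> initial_ideal n (gl_act n g ` ?I) = J'"
      by blast
    obtain F where F: "\<forall>f\<in>F. regular_pol n f"
        "U = {g \<in> GL n. \<exists>f\<in>F. subst_pol id (\<lambda>e. g $$ e) f \<noteq> 0}"
      using U(1) unfolding zariski_open_GL_def regular_pol_def by blast
    obtain f' g' where f': "f' \<in> F" "g' \<in> GL n" "subst_pol id (\<lambda>e. g' $$ e) f' \<noteq> 0"
      using U(2) F(2) by blast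
    have "regular n (\<lambda>g. subst_pol id (\<lambda>e. g $$ e) f')"
      unfolding regular_def using F(1) f'(1) by blast
    moreover have "\<exists>g\<in>carrier_mat n n. subst_pol id (\<lambda>e. g $$ e) f' \<noteq> 0"
      using f'(2,3) by (auto simp: GL_def)
    ultimately obtain g where "g \<in> GL n" "subst_pol id (\<lambda>e. g $$ e) f' \<noteq> 0" "general_position n g \<noteq> 0"
      using regular_GL_nonzero[OF _ regular_general_position _ ex_general_position] by blast
    then show "J' = ?J"
      using J[of g] U(3)[of g] F(2) f'(1) by blast
  qed
qed

section \<open>Applying \<open>sigma\<close> to the minimal generators of the shifted ideal\<close>

lemma sigma_mon_of_shift_down: "xs \<in> T \<Longrightarrow> sigma t (mon_of (shift_down t xs)) = mon_of xs"
  by (simp add: sigma_eq indices_mon_of[OF sorted_shift_down[OF spread_T]] shift_up_down[OF spread_T])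

text \<open>If the shift of \<open>zs\<close> divides the shift of \<open>xs\<close>, then the
  entries of \<open>xs\<close> are at most those of \<open>zs\<close>, so a prefix of
  \<open>xs\<close> lies in \<open>T\<close>. Prefix minimality forces equal lengths, and the
  divisor is the whole monomial.\<close>

lemma mon_of_prefix_min:
  assumes xs: "xs \<in> prefix_min"
  shows "mon_of xs \<in> sigma t ` minimals n (mon_of ` shift_down t ` T)"
proof -
  let ?N = "mon_of ` shift_down t ` T"
  have T: "xs \<in> T" using xs by (simp add: prefix_min_def)
  then have "mon_of (shift_down t xs) \<in> ?N"
    by blast
  then have "mon_of (shift_down t xs) \<in> up n (minimals n ?N)"
    unfolding up_minimals by (rule subsetD[OF subset_up])
  then obtain v y where v: "v \<in> minimals n ?N" "mon_of (shift_down t xs) = v + y"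
    unfolding up_def by blast
  have "v \<in> ?N"
    using v(1) by (rule subsetD[OF minimals_subset])
  then obtain zs where zs: "zs \<in> T" "v = mon_of (shift_down t zs)"
    by blast
  have dvd: "mon_of (shift_down t zs) + y = mon_of (shift_down t xs)"
    using v(2) zs(2) by simp
  note le = mon_of_dvd_nth_le[OF dvd sorted_shift_down[OF spread_T[OF zs(1)]]
      sorted_shift_down[OF spread_T[OF T]]]
  have len: "length zs \<le> length xs"
    using le(1) by simp
  have "xs ! p \<le> zs ! p" if p: "p < length zs" for p
    using le(2)[of p] p len spread_offset_le[OF spread_T[OF zs(1)] p] by simp
  then have "take (length zs) xs \<in> T"
    using len by (intro down_T[OF zs(1)] spread_take spread_T[OF T]) (simp add: list_all2_conv_all_nth)
  then have "\<not> length zs < length xs"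
    using xs by (auto simp: prefix_min_def)
  then have "mdeg y = 0"
    using arg_cong[OF dvd, of mdeg] len by simp
  then have "mon_of (shift_down t xs) = v"
    using v(2) mdeg_eq_0_iff by simp
  then show ?thesis
    using sigma_mon_of_shift_down[OF T] v(1) by (intro image_eqI[of _ _ v]) simp_all
qed

text \<open>The map \<open>sigma t\<close> undoes the shift on \<open>T\<close>, which gives one
  inclusion. For the other, each list of \<open>T\<close> is a multiple of its shortest prefix in
  \<open>T\<close>, and the monomial of that prefix is reached by
  \<open>mon_of_prefix_min\<close>.\<close>

lemma up_sigma_minimals:
  "up n (sigma t ` minimals n (mon_of ` shift_down t ` T)) = up n (mon_of ` T)"
proof
  have "sigma t ` minimals n (mon_of ` shift_down t ` T) \<subseteq> sigma t ` mon_of ` shift_down t ` T"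
    by (intro image_mono minimals_subset)
  also have "\<dots> \<subseteq> mon_of ` T"
    using sigma_mon_of_shift_down by auto
  finally have "sigma t ` minimals n (mon_of ` shift_down t ` T) \<subseteq> mon_of ` T" .
  then show "up n (sigma t ` minimals n (mon_of ` shift_down t ` T)) \<subseteq> up n (mon_of ` T)"
    by (rule up_mono)
  have "mon_of xs \<in> up n (sigma t ` minimals n (mon_of ` shift_down t ` T))" if xs: "xs \<in> T" for xs
  proof -
    define k where "k = (LEAST k. take k xs \<in> T)"
    have "take (length xs) xs \<in> T" using xs by simp
    then have k: "take k xs \<in> T"
      unfolding k_def by (rule LeastI)
    have "take j (take k xs) \<notin> T" if "j < length (take k xs)" for j
    proof -
      have "j < k" using that by simp
      moreover from this have "take j xs \<notin> T"
        unfolding k_def by (rule not_less_Least)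
      ultimately show ?thesis
        by (simp add: min_def)
    qed
    then have "take k xs \<in> prefix_min"
      using k by (simp add: prefix_min_def)
    then have "mon_of (take k xs) \<in> up n (sigma t ` minimals n (mon_of ` shift_down t ` T))"
      by (intro subsetD[OF subset_up] mon_of_prefix_min)
    moreover have "mon_of (drop k xs) \<in> mons n"
      using bound_T[OF xs] set_drop_subset[of k xs] by (auto simp: mon_of_in_mons)
    ultimately have "mon_of (take k xs) + mon_of (drop k xs)
        \<in> up n (sigma t ` minimals n (mon_of ` shift_down t ` T))"
      by (rule up_add)
    then show ?thesis
      by (simp flip: mon_of_append)
  qed
  then have "up n (mon_of ` T) \<subseteq> up n (up n (sigma t ` minimals n (mon_of ` shift_down t ` T)))"
    by (intro up_mono) blast
  then show "up n (mon_of ` T) \<subseteq> up n (sigma t ` minimals n (mon_of ` shift_down t ` T))"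
    by simp
qed

theorem Gin_sigma:
  defines "I \<equiv> polys (up n (mon_of ` T)) :: 'a::field_char_0 pol set"
  shows "u \<in> G n (Gin n I) \<Longrightarrow> \<exists>xs\<in>T. mdeg u = length xs \<and> sigma t u = mon_of xs"
    and "sigma_ideal n t (Gin n I) = I"
proof -
  let ?N = "mon_of ` shift_down t ` T"
  have N: "?N \<subseteq> mons n"
    by (rule order_trans[OF subset_up up_T_subset_mons(2)])
  have G: "G n (Gin n I) = minimals n ?N"
    unfolding I_def Gin_up by (rule G_polys_up[OF N])
  show *: "\<exists>xs\<in>T. mdeg u = length xs \<and> sigma t u = mon_of xs" if u: "u \<in> G n (Gin n I)" for u
  proof -
    have "u \<in> ?N"
      using u unfolding G by (rule subsetD[OF minimals_subset])
    then obtain xs where "xs \<in> T" "u = mon_of (shift_down t xs)"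
      by blast
    then show ?thesis
      using sigma_mon_of_shift_down by auto
  qed
  have "sigma t ` minimals n ?N \<subseteq> mons n"
    using * bound_T unfolding G by (force simp: mon_of_in_mons)
  then show "sigma_ideal n t (Gin n I) = I"
    unfolding sigma_ideal_def G by (simp add: mon_ideal_eq up_sigma_minimals I_def)
qed

end

section \<open>Strongly stable ideals in terms of lists, and the conclusion\<close>

lemma mon_of_list_update:
  assumes "p < length xs"
  shows "mon_of (xs[p := q]) = var q + (mon_of xs - var (xs ! p))"
proof -
  have "mon_of (xs[p := q]) + var (xs ! p) = var (xs ! p) + (mon_of xs - var (xs ! p)) + var q"
    using mon_of_list_update_add[OF assms] var_add_minus[of "xs ! p" "mon_of xs"] assms by simp
  also have "\<dots> = var q + (mon_of xs - var (xs ! p)) + var (xs ! p)"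
    by (simp only: ac_simps)
  finally show ?thesis
    by (rule add_right_imp_eq)
qed

text \<open>The entries of \<open>xs\<close> are replaced by those of \<open>ys\<close> from left to
  right. Each replacement is trivial or one exchange as in the definition of strong
  stability.\<close>

lemma t_spread_strongly_stable_down:
  assumes I: "t_spread_strongly_stable n d t I"
    and xs: "spread t xs" "length xs \<le> d" "mon_pol (mon_of xs) \<in> I"
    and ys: "spread t ys" "list_all2 (\<le>) ys xs"
  shows "mon_pol (mon_of ys) \<in> I"
proof -
  have len: "length ys = length xs" and le: "\<And>p. p < length xs \<Longrightarrow> ys ! p \<le> xs ! p"
    using ys(2) by (auto simp: list_all2_conv_all_nth)
  \<comment> \<open>The first k entries come from \<open>ys\<close>, the others from
    \<open>xs\<close>. At the seam the gap condition survives, since the entry of \<open>ys\<close>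
    is at most the entry of \<open>xs\<close> it replaces.\<close>
  define zs where "zs k = map (\<lambda>p. if p < k then ys ! p else xs ! p) [0..<length xs]" for k
  have zs: "length (zs k) = length xs" "p < length xs \<Longrightarrow> zs k ! p = (if p < k then ys ! p else xs ! p)" for k p
    by (simp_all add: zs_def)
  have spread: "spread t (zs k)" for k
    unfolding spread_def
  proof (intro allI impI)
    fix r assume r: "Suc r < length (zs k)"
    have "xs ! r + t (Suc r) \<le> xs ! Suc r" "ys ! r + t (Suc r) \<le> ys ! Suc r"
      using xs(1) ys(1) r len by (auto simp: spread_def zs)
    then show "zs k ! r + t (Suc r) \<le> zs k ! Suc r"
      using r le[of r] by (auto simp: zs)
  qed
  then have t_spread: "t_spread d t (mon_of (zs k))" for k
    using xs(2) by (simp add: t_spread_iff zs indices_mon_of[OF spread_sorted[OF spread]])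
  have "mon_pol (mon_of (zs k)) \<in> I" if "k \<le> length xs" for k
    using that
  proof (induction k)
    case 0
    have "zs 0 = xs" by (simp add: zs_def map_nth)
    then show ?case using xs(3) by simp
  next
    case (Suc k)
    then have k: "k < length xs" and IH: "mon_pol (mon_of (zs k)) \<in> I" by auto
    have upd: "zs (Suc k) = (zs k)[k := ys ! k]"
      using k by (intro nth_equalityI) (auto simp: zs nth_list_update less_Suc_eq)
    have i: "zs k ! k = xs ! k"
      using k by (simp add: zs)
    show ?case
    proof (cases "ys ! k = xs ! k")
      case True
      then have "zs (Suc k) = zs k"
        unfolding upd using i by (metis list_update_id)
      then show ?thesis using IH by simp
    next
      case False
      have eq: "mon_of (zs (Suc k)) = var (ys ! k) + (mon_of (zs k) - var (xs ! k))"
        unfolding upd using mon_of_list_update[of k "zs k" "ys ! k"] k i by (simp add: zs)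
      have "ys ! k < xs ! k" using False le[OF k] by simp
      moreover have "xs ! k \<in> keys (mon_of (zs k))"
        using i k nth_mem[of k "zs k"] by (simp add: zs)
      ultimately show ?thesis
        using I IH t_spread[of k] t_spread[of "Suc k"] unfolding eq t_spread_strongly_stable_def by blast
    qed
  qed
  moreover have "zs (length xs) = ys"
    using len by (intro nth_equalityI) (auto simp: zs)
  ultimately show ?thesis by auto
qed

theorem theorem5p5:
  fixes n d :: nat
    and t :: "nat \<Rightarrow> nat"
    and I :: "'a::field_char_0 pol set"
  assumes "d \<ge> 2"
    and "t_spread_strongly_stable n d t I"
  shows "(\<forall>u\<in>G n (Gin n I). mdeg u \<le> d \<and> sigma t u \<in> mons n)
    \<and> I = sigma_ideal n t (Gin n I)"
proof -
  obtain M where M: "M \<subseteq> mons n" "I = mon_ideal n M" and gen: "\<forall>u\<in>G n I. t_spread d t u"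
    using assms(2) by (auto simp: t_spread_strongly_stable_def t_spread_ideal_def monomial_ideal_def)
  have IM: "I = polys (up n M)"
    using M mon_ideal_eq by blast
  \<comment> \<open>The index lists of the t-spread monomials of the ideal. The bound d on the
    length makes \<open>T\<close> finite and later bounds the degrees of the generators of the
    generic initial ideal.\<close>
  define T where "T = {xs. spread t xs \<and> length xs \<le> d \<and> mon_pol (mon_of xs) \<in> I}"
  have bound: "set xs \<subseteq> {..<n}" if "xs \<in> T" for xs
  proof -
    have "mon_of xs \<in> up n M"
      using that by (simp add: T_def IM mon_pol_in_polys_iff)
    then have "mon_of xs \<in> mons n"
      by (rule subsetD[OF up_subset_mons[OF M(1)]])
    then show ?thesis
      by (simp add: mon_of_in_mons)
  qed
  interpret spread_stable t n T
  proof
    have "T \<subseteq> {xs. set xs \<subseteq> {..<n} \<and> length xs \<le> d}"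
      using bound by (auto simp: T_def)
    then show "finite T"
      using finite_lists_length_le[of "{..<n}" d] finite_subset by blast
    show "ys \<in> T" if "xs \<in> T" "spread t ys" "list_all2 (\<le>) ys xs" for xs ys
      using that t_spread_strongly_stable_down[OF assms(2), of xs ys]
      by (auto simp: T_def dest: list_all2_lengthD)
  qed (use bound in \<open>auto simp: T_def\<close>)
  \<comment> \<open>The minimal generators are t-spread and hence come from \<open>T\<close>, so
    \<open>T\<close> generates the same ideal as \<open>M\<close>.\<close>
  have "up n (mon_of ` T) = up n M"
  proof
    have "mon_of ` T \<subseteq> up n M"
      by (auto simp: T_def IM mon_pol_in_polys_iff)
    then show "up n (mon_of ` T) \<subseteq> up n M"
      using up_mono[of "mon_of ` T" "up n M" n] by simp
    have "minimals n M \<subseteq> mon_of ` T"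
    proof
      fix u assume u: "u \<in> minimals n M"
      then have "t_spread d t u"
        using gen unfolding IM G_polys_up[OF M(1)] by blast
      moreover have "mon_pol u \<in> I"
        using u by (simp add: IM mon_pol_in_polys_iff minimals_def)
      ultimately have "indices u \<in> T"
        by (simp add: T_def t_spread_iff)
      then show "u \<in> mon_of ` T"
        by (metis image_eqI mon_of_indices)
    qed
    then show "up n M \<subseteq> up n (mon_of ` T)"
      using up_mono[of "minimals n M" "mon_of ` T" n] by (simp add: up_minimals)
  qed
  then have I: "I = polys (up n (mon_of ` T))"
    by (simp add: IM)
  have "mdeg u \<le> d \<and> sigma t u \<in> mons n" if u: "u \<in> G n (Gin n I)" for u
  proof -
    obtain xs where "xs \<in> T" "mdeg u = length xs" "sigma t u = mon_of xs"
      using Gin_sigma(1) u unfolding I by blast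
    then show ?thesis
      using bound[of xs] by (simp add: T_def mon_of_in_mons)
  qed
  moreover have "sigma_ideal n t (Gin n I) = I"
    unfolding I by (rule Gin_sigma(2))
  ultimately show ?thesis
    by simp
qed

end
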